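(* Let $K$ be a field, $n\ge 1$, and let $\Lambda_n$ be the algebra of lower triangular $n\times n$ matrices over $K$. A finitely generated left $\Lambda_n$-module $M$ is faithfully balanced if and only if it satisfies the following three conditions: (FB0) $M_{1n}$ is a direct summand of $M$ (up to isomorphism); (FB1) whenever $M_{ij}$ (with $1\le i\le j\le n$) is a summand of $M$ and $(i,j)\neq(1,n)$, then $\mathrm{cohook}(i,j)$ contains a summand of $M$; (FB2) every virtual cohook contains a summand of $M$, i.e. for every $i\in\{1,\dots,n+1\}$ the set $\mathrm{cohook}(i,i-1)$ contains a summand of $M$.
   Context: A module $M$ over an algebra $\Lambda$ is faithfully balanced if the natural map $\Lambda\to\mathrm{End}_E(M)$, where $E=\mathrm{End}_\Lambda(M)$, is bijective. $\Lambda_n$ is equivalently the path algebra of the linear quiver $1\to 2\to\cdots\to n$. Its indecomposable modules are, up to isomorphism, the modules $M_{ij}$ with $1\le i\le j\le n$, where $M_{ij}$ is the uniserial module with top the simple $S[i]$ and socle the simple $S[j]$ (the representation with $K$ at vertices $i,\dots,j$, identity maps between them, and $0$ elsewhere). For $(i,j)$ with either $1\le i\le j\le n$, or $(i,j)\in L=\{(1,0),(2,1),\dots,(n+1,n)\}$ (the "leaves"), put $$\mathrm{cohook}(i,j)=\{M_{kj}:1\le k<i\}\cup\{M_{i\ell}: j<\ell\le n\}.$$ (If $i=1$ the first set is empty; if $j=n$ the second set is empty.) When $(i,j)\in L$ it is called a virtual cohook. *)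

theory Defs
  imports "HOL-Algebra.Module" "HOL-Algebra.AbelCoset" "Jordan_Normal_Form.Matrix"
begin

section \<open>Left modules over a ring that need not be commutative\<close>

text \<open>
  The locale \<open>module\<close> of HOL-Algebra requires a commutative ring of scalars; the following is
  the same axiomatisation over an arbitrary ring (with one). The predicate \<open>submodule\<close> of
  HOL-Algebra makes no commutativity assumption and is used as it is.
\<close>

locale left_module = R?: ring R + M?: abelian_group M
  for R :: "('r, 'x) ring_scheme" (structure) and M :: "('r, 'b, 'y) module_scheme" (structure) +
  assumes smult_closed:
      "\<lbrakk>a \<in> carrier R; x \<in> carrier M\<rbrakk> \<Longrightarrow> a \<odot>\<^bsub>M\<^esub> x \<in> carrier M"
    and smult_l_distr:
      "\<lbrakk>a \<in> carrier R; b \<in> carrier R; x \<in> carrier M\<rbrakk> \<Longrightarrow>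
      (a \<oplus>\<^bsub>R\<^esub> b) \<odot>\<^bsub>M\<^esub> x = a \<odot>\<^bsub>M\<^esub> x \<oplus>\<^bsub>M\<^esub> b \<odot>\<^bsub>M\<^esub> x"
    and smult_r_distr:
      "\<lbrakk>a \<in> carrier R; x \<in> carrier M; y \<in> carrier M\<rbrakk> \<Longrightarrow>
      a \<odot>\<^bsub>M\<^esub> (x \<oplus>\<^bsub>M\<^esub> y) = a \<odot>\<^bsub>M\<^esub> x \<oplus>\<^bsub>M\<^esub> a \<odot>\<^bsub>M\<^esub> y"
    and smult_assoc:
      "\<lbrakk>a \<in> carrier R; b \<in> carrier R; x \<in> carrier M\<rbrakk> \<Longrightarrow>
      (a \<otimes>\<^bsub>R\<^esub> b) \<odot>\<^bsub>M\<^esub> x = a \<odot>\<^bsub>M\<^esub> (b \<odot>\<^bsub>M\<^esub> x)"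
    and smult_one:
      "x \<in> carrier M \<Longrightarrow> \<one>\<^bsub>R\<^esub> \<odot>\<^bsub>M\<^esub> x = x"

definition finitely_generated ::
  "('r, 'x) ring_scheme \<Rightarrow> ('r, 'b, 'y) module_scheme \<Rightarrow> bool" where
  "finitely_generated R M \<longleftrightarrow>
     (\<exists>S. finite S \<and> S \<subseteq> carrier M \<and> (\<forall>N. submodule N R M \<and> S \<subseteq> N \<longrightarrow> N = carrier M))"

text \<open>
  Homomorphisms are extensional functions, so that two of them are equal as soon as they agree on
  the carrier.
\<close>

definition lmod_hom ::
  "('r, 'x) ring_scheme \<Rightarrow> ('r, 'b, 'y) module_scheme \<Rightarrow> ('r, 'c, 'z) module_scheme
    \<Rightarrow> ('b \<Rightarrow> 'c) set" where
  "lmod_hom R M N =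
     {f \<in> carrier M \<rightarrow>\<^sub>E carrier N.
        (\<forall>x\<in>carrier M. \<forall>y\<in>carrier M. f (x \<oplus>\<^bsub>M\<^esub> y) = f x \<oplus>\<^bsub>N\<^esub> f y) \<and>
        (\<forall>a\<in>carrier R. \<forall>x\<in>carrier M. f (a \<odot>\<^bsub>M\<^esub> x) = a \<odot>\<^bsub>N\<^esub> f x)}"

definition lmod_iso ::
  "('r, 'x) ring_scheme \<Rightarrow> ('r, 'b, 'y) module_scheme \<Rightarrow> ('r, 'c, 'z) module_scheme \<Rightarrow> bool" where
  "lmod_iso R M N \<longleftrightarrow> (\<exists>f \<in> lmod_hom R M N. bij_betw f (carrier M) (carrier N))"

text \<open>\<open>N\<close> is isomorphic to a direct summand of \<open>M\<close>.\<close>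

definition is_summand ::
  "('r, 'x) ring_scheme \<Rightarrow> ('r, 'c, 'z) module_scheme \<Rightarrow> ('r, 'b, 'y) module_scheme \<Rightarrow> bool" where
  "is_summand R N M \<longleftrightarrow>
     (\<exists>U V. submodule U R M \<and> submodule V R M \<and>
        U \<inter> V = {\<zero>\<^bsub>M\<^esub>} \<and> U <+>\<^bsub>M\<^esub> V = carrier M \<and>
        lmod_iso R N (M\<lparr>carrier := U\<rparr>))"

section \<open>Faithfully balanced modules\<close>

definition End_ring ::
  "('r, 'x) ring_scheme \<Rightarrow> ('r, 'b, 'y) module_scheme \<Rightarrow> ('b \<Rightarrow> 'b) ring" where
  "End_ring R M =
     \<lparr>carrier = lmod_hom R M M,
      monoid.mult = compose (carrier M),
      one = (\<lambda>x\<in>carrier M. x),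
      zero = (\<lambda>x\<in>carrier M. \<zero>\<^bsub>M\<^esub>),
      add = (\<lambda>f g. \<lambda>x\<in>carrier M. f x \<oplus>\<^bsub>M\<^esub> g x)\<rparr>"

text \<open>
  \<open>M\<close> with its tautological left action of \<open>End_ring R M\<close>; the multiplicative fields of a module
  record play no role.
\<close>

definition End_module :: "('r, 'b, 'y) module_scheme \<Rightarrow> ('b \<Rightarrow> 'b, 'b) module" where
  "End_module M =
     \<lparr>carrier = carrier M, monoid.mult = undefined, one = undefined,
      zero = \<zero>\<^bsub>M\<^esub>, add = add M, smult = (\<lambda>f x. f x)\<rparr>"

definition faithfully_balanced ::
  "('r, 'x) ring_scheme \<Rightarrow> ('r, 'b, 'y) module_scheme \<Rightarrow> bool" where
  "faithfully_balanced R M \<longleftrightarrow>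
     bij_betw (\<lambda>a. \<lambda>x\<in>carrier M. a \<odot>\<^bsub>M\<^esub> x)
       (carrier R) (carrier (End_ring (End_ring R M) (End_module M)))"

section \<open>Lower triangular matrices and their indecomposable modules\<close>

definition lower_triangular_ring :: "'a :: field itself \<Rightarrow> nat \<Rightarrow> 'a mat ring" where
  "lower_triangular_ring ty n =
     (ring_mat ty n ())\<lparr>carrier :=
        {A \<in> carrier_mat n n. \<forall>p<n. \<forall>q<n. p < q \<longrightarrow> A $$ (p, q) = 0}\<rparr>"

text \<open>
  The module \<open>M\<^sub>i\<^sub>j\<close>, that is, the representation of the quiver \<open>1 \<rightarrow> 2 \<rightarrow> \<dots> \<rightarrow> n\<close> with the field
  at the vertices \<open>i, \<dots>, j\<close>, identity maps between them and zero elsewhere. Vectors and matrices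
  are indexed from 0, so vertex \<open>v\<close> corresponds to the index \<open>v - 1\<close>. The matrix unit with entry 1
  in row \<open>q\<close> and column \<open>p\<close>, where \<open>p \<le> q\<close>, is the path from \<open>p\<close> to \<open>q\<close>. Equivalently, this is
  the quotient of the submodule of column vectors supported on \<open>i, \<dots>, n\<close> by those supported on
  \<open>j + 1, \<dots>, n\<close>: hence the truncation in the action. The top is the simple module at \<open>i\<close> and the
  socle the simple module at \<open>j\<close>.
\<close>

definition interval_module :: "nat \<Rightarrow> nat \<Rightarrow> nat \<Rightarrow> ('a :: field mat, 'a vec) module" where
  "interval_module n i j =
     \<lparr>carrier = {x \<in> carrier_vec n. \<forall>p<n. x $ p \<noteq> 0 \<longrightarrow> i \<le> Suc p \<and> Suc p \<le> j},
      monoid.mult = undefined, one = undefined,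
      zero = 0\<^sub>v n, add = (+),
      smult = (\<lambda>A x. vec n (\<lambda>p. if i \<le> Suc p \<and> Suc p \<le> j then (A *\<^sub>v x) $ p else 0))\<rparr>"

text \<open>The virtual cohooks are the sets \<open>cohook n i (i - 1)\<close> with \<open>1 \<le> i \<le> n + 1\<close>.\<close>

definition cohook :: "nat \<Rightarrow> nat \<Rightarrow> nat \<Rightarrow> ('a :: field mat, 'a vec) module set" where
  "cohook n i j =
     {interval_module n k j | k. 1 \<le> k \<and> k < i} \<union> {interval_module n i l | l. j < l \<and> l \<le> n}"

end

theory Submission
  imports Defs
begin

text \<open>
  A finitely generated module over the lower triangular matrices is a direct sum of interval
  modules: among all families of a fixed shape that consist of generators each living at one
  vertex, take one with the fewest nonzero translates along the quiver. In a nontrivial relation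
  between translates at a vertex, the generator that starts latest can be replaced by the
  combination of the translates at its own start. The new generator dies earlier, so in a minimal
  family the nonzero translates form a basis.

  In such a basis an element of the bicommutant has a matrix \<open>a\<close>, namely its coefficients on the
  summand \<open>M\<^sub>1\<^sub>n\<close>, and it acts on every other summand by the truncation of \<open>a\<close>: a member of the
  cohook of \<open>M\<^sub>i\<^sub>j\<close> contains \<open>M\<^sub>i\<^sub>j\<close> or maps onto it, so one can climb up to \<open>M\<^sub>1\<^sub>n\<close>. Comparing
  coefficients along these maps also shows that \<open>a\<close> is lower triangular once every virtual cohook
  is met. Conversely, if the cohook of a summand \<open>M\<^sub>i\<^sub>j\<close> is missed, then moving vertex \<open>i\<close> to vertex
  \<open>j\<close> on the summands \<open>M\<^sub>i\<^sub>j\<close> only commutes with all endomorphisms, and if the virtual cohook at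
  \<open>i\<close> is missed, then the arrow into \<open>i\<close> acts bijectively and its inverse lies in the bicommutant.
\<close>

section \<open>Faithful balance without extensionality\<close>

abbreviation LT :: "nat \<Rightarrow> 'a::field mat ring" where
  "LT n \<equiv> lower_triangular_ring TYPE('a) n"

lemma LT_simps [simp]:
  "monoid.mult (LT n) = (*)" "add (LT n) = (+)" "one (LT n) = 1\<^sub>m n" "zero (LT n) = 0\<^sub>m n n"
  by (simp_all add: lower_triangular_ring_def ring_mat_def)

lemma mem_LT:
  "A \<in> carrier (LT n) \<longleftrightarrow>
    A \<in> carrier_mat n n \<and> (\<forall>p<n. \<forall>q<n. p < q \<longrightarrow> A $$ (p, q) = 0)"
  by (simp add: lower_triangular_ring_def)

text \<open>With vertices counted from 0, this is the path from \<open>p\<close> to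
  \<open>q\<close>, and for \<open>q = p\<close> the idempotent of the vertex
  \<open>p\<close>.\<close>

definition munit :: "nat \<Rightarrow> nat \<Rightarrow> nat \<Rightarrow> 'a::field mat" where
  "munit n q p = mat n n (\<lambda>(r, c). if r = q \<and> c = p then 1 else 0)"

lemma munit_LT: "p \<le> q \<Longrightarrow> munit n q p \<in> carrier (LT n)"
  by (auto simp: mem_LT munit_def)

lemma smult_one_LT: "c \<cdot>\<^sub>m 1\<^sub>m n \<in> carrier (LT n)"
  by (auto simp: mem_LT)

text \<open>In contrast to \<open>lmod_hom\<close>, nothing is prescribed off the carrier, so
  endomorphisms can be given by plain lambda terms.\<close>

definition lmod_endo :: "('r, 'x) ring_scheme \<Rightarrow> ('r, 'b, 'y) module_scheme \<Rightarrow> ('b \<Rightarrow> 'b) \<Rightarrow> bool" where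
  "lmod_endo R M f \<longleftrightarrow>
     (\<forall>x\<in>carrier M. f x \<in> carrier M) \<and>
     (\<forall>x\<in>carrier M. \<forall>y\<in>carrier M. f (x \<oplus>\<^bsub>M\<^esub> y) = f x \<oplus>\<^bsub>M\<^esub> f y) \<and>
     (\<forall>a\<in>carrier R. \<forall>x\<in>carrier M. f (a \<odot>\<^bsub>M\<^esub> x) = a \<odot>\<^bsub>M\<^esub> f x)"

text \<open>Up to values off the carrier, these are the endomorphisms of \<open>M\<close> over its
  endomorphism ring.\<close>

definition bicommutant :: "('r, 'x) ring_scheme \<Rightarrow> ('r, 'b, 'y) module_scheme \<Rightarrow> ('b \<Rightarrow> 'b) \<Rightarrow> bool" where
  "bicommutant R M \<phi> \<longleftrightarrow>
     (\<forall>x\<in>carrier M. \<phi> x \<in> carrier M) \<and>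
     (\<forall>x\<in>carrier M. \<forall>y\<in>carrier M. \<phi> (x \<oplus>\<^bsub>M\<^esub> y) = \<phi> x \<oplus>\<^bsub>M\<^esub> \<phi> y) \<and>
     (\<forall>f. lmod_endo R M f \<longrightarrow> (\<forall>x\<in>carrier M. \<phi> (f x) = f (\<phi> x)))"

lemma restrict_lmod_endo:
  assumes "lmod_endo R M f"
    and "\<And>x y. x \<in> carrier M \<Longrightarrow> y \<in> carrier M \<Longrightarrow> x \<oplus>\<^bsub>M\<^esub> y \<in> carrier M"
    and "\<And>a x. a \<in> carrier R \<Longrightarrow> x \<in> carrier M \<Longrightarrow> a \<odot>\<^bsub>M\<^esub> x \<in> carrier M"
  shows "restrict f (carrier M) \<in> lmod_hom R M M"
  using assms by (auto simp: lmod_hom_def lmod_endo_def)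

text \<open>Restriction to the carrier matches these maps with the extensional ones that form the
  two endomorphism rings, so the natural map can be tested pointwise.\<close>

lemma (in left_module) faithfully_balanced_iff:
  "faithfully_balanced R M \<longleftrightarrow>
    (\<forall>a\<in>carrier R. \<forall>b\<in>carrier R. (\<forall>x\<in>carrier M. a \<odot>\<^bsub>M\<^esub> x = b \<odot>\<^bsub>M\<^esub> x) \<longrightarrow> a = b) \<and>
    (\<forall>\<phi>. bicommutant R M \<phi> \<longrightarrow> (\<exists>a\<in>carrier R. \<forall>x\<in>carrier M. \<phi> x = a \<odot>\<^bsub>M\<^esub> x))"
    (is "_ \<longleftrightarrow> ?inj \<and> ?surj")
proof -
  let ?act = "\<lambda>a. \<lambda>x\<in>carrier M. a \<odot>\<^bsub>M\<^esub> x"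
  let ?B = "carrier (End_ring (End_ring R M) (End_module M))"
  have mem: "\<phi> \<in> ?B \<longleftrightarrow> \<phi> \<in> carrier M \<rightarrow>\<^sub>E carrier M \<and>
      (\<forall>x\<in>carrier M. \<forall>y\<in>carrier M. \<phi> (x \<oplus>\<^bsub>M\<^esub> y) = \<phi> x \<oplus>\<^bsub>M\<^esub> \<phi> y) \<and>
      (\<forall>f\<in>lmod_hom R M M. \<forall>x\<in>carrier M. \<phi> (f x) = f (\<phi> x))" for \<phi>
    by (simp add: End_ring_def End_module_def lmod_hom_def[of "End_ring R M" for R M]
        lmod_hom_def[of "\<lparr>carrier = C, \<dots> = Z\<rparr>" for C Z])
  have B: "\<phi> \<in> ?B \<longleftrightarrow> \<phi> \<in> extensional (carrier M) \<and> bicommutant R M \<phi>" for \<phi>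
  proof
    assume "\<phi> \<in> ?B"
    then have \<phi>: "\<phi> \<in> carrier M \<rightarrow>\<^sub>E carrier M"
        "\<And>x y. x \<in> carrier M \<Longrightarrow> y \<in> carrier M \<Longrightarrow> \<phi> (x \<oplus>\<^bsub>M\<^esub> y) = \<phi> x \<oplus>\<^bsub>M\<^esub> \<phi> y"
        "\<And>f x. f \<in> lmod_hom R M M \<Longrightarrow> x \<in> carrier M \<Longrightarrow> \<phi> (f x) = f (\<phi> x)"
      unfolding mem by blast+
    \<comment> \<open>\<open>f\<close> and its restriction agree at \<open>x\<close> and at
      \<open>\<phi> x\<close>, since both lie in the carrier.\<close>
    have "\<phi> (f x) = f (\<phi> x)" if "lmod_endo R M f" "x \<in> carrier M" for f x
      using \<phi>(3)[OF restrict_lmod_endo[OF that(1) M.a_closed smult_closed] that(2)] PiE_mem[OF \<phi>(1) that(2)] that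
      by auto
    then show "\<phi> \<in> extensional (carrier M) \<and> bicommutant R M \<phi>"
      using \<phi> by (auto simp: bicommutant_def PiE_def)
  next
    assume \<phi>: "\<phi> \<in> extensional (carrier M) \<and> bicommutant R M \<phi>"
    have "lmod_endo R M f" if "f \<in> lmod_hom R M M" for f
      using that by (auto simp: lmod_hom_def lmod_endo_def)
    then show "\<phi> \<in> ?B"
      using \<phi> unfolding mem by (auto simp: bicommutant_def PiE_def)
  qed
  have act: "?act a \<in> ?B" if "a \<in> carrier R" for a
    unfolding B using that by (auto simp: bicommutant_def lmod_endo_def smult_closed smult_r_distr)
  have "inj_on ?act (carrier R) \<longleftrightarrow> ?inj"
    unfolding inj_on_def by (simp add: fun_eq_iff restrict_def) metis
  moreover have "?act ` carrier R = ?B \<longleftrightarrow> ?surj"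
  proof
    assume im: "?act ` carrier R = ?B"
    show ?surj
    proof (intro allI impI)
      fix \<phi> assume \<phi>: "bicommutant R M \<phi>"
      then have "restrict \<phi> (carrier M) \<in> ?B"
        unfolding B by (auto simp: bicommutant_def lmod_endo_def)
      then obtain a where "a \<in> carrier R" "restrict \<phi> (carrier M) = ?act a"
        using im by blast
      then show "\<exists>a\<in>carrier R. \<forall>x\<in>carrier M. \<phi> x = a \<odot>\<^bsub>M\<^esub> x"
        by (metis restrict_apply')
    qed
  next
    assume s: ?surj
    show "?act ` carrier R = ?B"
    proof
      show "?act ` carrier R \<subseteq> ?B" using act by blast
      show "?B \<subseteq> ?act ` carrier R"
      proof
        fix \<phi> assume "\<phi> \<in> ?B"
        then have \<phi>: "\<phi> \<in> extensional (carrier M)" "bicommutant R M \<phi>" using B by auto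
        then obtain a where a: "a \<in> carrier R" "\<forall>x\<in>carrier M. \<phi> x = a \<odot>\<^bsub>M\<^esub> x" using s by blast
        have "\<phi> = ?act a"
          using \<phi>(1) a(2) by (auto simp: fun_eq_iff extensional_def)
        then show "\<phi> \<in> ?act ` carrier R" using a(1) by blast
      qed
    qed
  qed
  ultimately show ?thesis
    unfolding faithfully_balanced_def bij_betw_def by simp
qed

section \<open>Direct sums of interval modules in coordinates\<close>

text \<open>
  Vertices are counted from 0, so the bar \<open>[s x, t x]\<close> carries the interval module with the indices
  \<open>Suc (s x)\<close> and \<open>Suc (t x)\<close>.
\<close>

definition barcode_module ::
  "nat \<Rightarrow> 'i set \<Rightarrow> ('i \<Rightarrow> nat) \<Rightarrow> ('i \<Rightarrow> nat) \<Rightarrow> ('a::field mat, 'i \<Rightarrow> nat \<Rightarrow> 'a) module" where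
  "barcode_module n X s t =
     \<lparr>carrier = {u. \<forall>x v. u x v \<noteq> 0 \<longrightarrow> x \<in> X \<and> s x \<le> v \<and> v \<le> t x},
      monoid.mult = undefined, one = undefined,
      zero = (\<lambda>x v. 0), add = (\<lambda>u w x v. u x v + w x v),
      smult = (\<lambda>A u x q. if x \<in> X \<and> s x \<le> q \<and> q \<le> t x then \<Sum>p<n. A $$ (q, p) * u x p else 0)\<rparr>"

definition single :: "'i \<Rightarrow> nat \<Rightarrow> 'a::zero \<Rightarrow> 'i \<Rightarrow> nat \<Rightarrow> 'a" where
  "single x p c = (\<lambda>y v. if y = x \<and> v = p then c else 0)"

locale barcode =
  fixes ty :: "'a::field itself" and n :: nat and X :: "'i set" and s t :: "'i \<Rightarrow> nat"
  assumes finite_X: "finite X"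
    and le: "x \<in> X \<Longrightarrow> s x \<le> t x"
    and less: "x \<in> X \<Longrightarrow> t x < n"
begin

abbreviation F :: "('a mat, 'i \<Rightarrow> nat \<Rightarrow> 'a) module" where
  "F \<equiv> barcode_module n X s t"

lemma mem_F: "u \<in> carrier F \<longleftrightarrow> (\<forall>x v. u x v \<noteq> 0 \<longrightarrow> x \<in> X \<and> s x \<le> v \<and> v \<le> t x)"
  by (simp add: barcode_module_def)

lemma F_eq_0: "u \<in> carrier F \<Longrightarrow> \<not> (x \<in> X \<and> s x \<le> v \<and> v \<le> t x) \<Longrightarrow> u x v = 0"
  unfolding mem_F by blast

lemma F_simps [simp]:
  "zero F = (\<lambda>x v. 0)" "u \<oplus>\<^bsub>F\<^esub> w = (\<lambda>x v. u x v + w x v)"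
  by (simp_all add: barcode_module_def)

lemma F_smult: "(A \<odot>\<^bsub>F\<^esub> u) x q =
    (if x \<in> X \<and> s x \<le> q \<and> q \<le> t x then \<Sum>p<n. A $$ (q, p) * u x p else 0)"
  by (simp add: barcode_module_def)

lemma F_smult_munit:
  assumes "p < n"
  shows "(munit n q p \<odot>\<^bsub>F\<^esub> u) x v = (if x \<in> X \<and> s x \<le> v \<and> v \<le> t x \<and> v = q then u x p else 0)"
proof -
  have "(\<Sum>r<n. munit n q p $$ (v, r) * u x r) = (if v = q then u x p else 0)" if "x \<in> X" "v \<le> t x"
  proof -
    have "v < n" using that less by fastforce
    then have "(\<Sum>r<n. munit n q p $$ (v, r) * u x r) = (\<Sum>r<n. if r = p then (if v = q then u x p else 0) else 0)"
      by (intro sum.cong) (auto simp: munit_def)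
    then show ?thesis using assms by (simp add: sum.delta)
  qed
  then show ?thesis by (auto simp: F_smult)
qed

text \<open>This recovers the vector space structure from the action of the ring.\<close>

lemma F_smult_scalar:
  assumes "u \<in> carrier F"
  shows "(c \<cdot>\<^sub>m 1\<^sub>m n) \<odot>\<^bsub>F\<^esub> u = (\<lambda>x v. c * u x v)"
proof (intro ext)
  fix x v
  have "(\<Sum>p<n. (c \<cdot>\<^sub>m 1\<^sub>m n) $$ (v, p) * u x p) = c * u x v" if "x \<in> X" "v \<le> t x"
  proof -
    have "v < n" using that less by fastforce
    then have "(\<Sum>p<n. (c \<cdot>\<^sub>m 1\<^sub>m n) $$ (v, p) * u x p) = (\<Sum>p<n. if p = v then c * u x v else 0)"
      by (intro sum.cong) auto
    then show ?thesis using \<open>v < n\<close> by (simp add: sum.delta)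
  qed
  then show "((c \<cdot>\<^sub>m 1\<^sub>m n) \<odot>\<^bsub>F\<^esub> u) x v = c * u x v"
    using F_eq_0[OF assms, of x v] by (auto simp: F_smult)
qed

lemma F_smult_single:
  assumes "p < n"
  shows "(A \<odot>\<^bsub>F\<^esub> single x p c) y q =
    (if y = x \<and> x \<in> X \<and> s x \<le> q \<and> q \<le> t x then A $$ (q, p) * c else 0)"
proof (cases "y = x")
  case True
  have "(\<Sum>r<n. A $$ (q, r) * single x p c x r) = (\<Sum>r<n. if r = p then A $$ (q, p) * c else 0)"
    by (intro sum.cong) (auto simp: single_def)
  then show ?thesis using assms True by (simp add: F_smult sum.delta)
qed (simp add: F_smult single_def)

lemma F_add_closed: "u \<in> carrier F \<Longrightarrow> w \<in> carrier F \<Longrightarrow> u \<oplus>\<^bsub>F\<^esub> w \<in> carrier F"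
  unfolding mem_F by (metis (mono_tags) F_simps(2) add_cancel_left_left)

lemma F_smult_closed: "A \<odot>\<^bsub>F\<^esub> u \<in> carrier F"
  by (auto simp: mem_F F_smult split: if_splits)

lemma F_smult_r_distr: "A \<odot>\<^bsub>F\<^esub> (u \<oplus>\<^bsub>F\<^esub> w) = A \<odot>\<^bsub>F\<^esub> u \<oplus>\<^bsub>F\<^esub> A \<odot>\<^bsub>F\<^esub> w"
  by (auto simp: fun_eq_iff F_smult distrib_left sum.distrib)

lemma single_mem: "x \<in> X \<Longrightarrow> s x \<le> p \<Longrightarrow> p \<le> t x \<Longrightarrow> single x p c \<in> carrier F"
  by (auto simp: mem_F single_def split: if_splits)

text \<open>The bars are finite in number and length, so a vector is built up one coordinate at a
  time. For additive maps this reduces claims to multiples of basis vectors.\<close>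

lemma F_induct [consumes 1, case_names zero single add]:
  assumes u: "u \<in> carrier F"
    and 0: "P (\<lambda>x v. 0)"
    and single: "\<And>x p c. x \<in> X \<Longrightarrow> s x \<le> p \<Longrightarrow> p \<le> t x \<Longrightarrow> P (single x p c)"
    and add: "\<And>u w. u \<in> carrier F \<Longrightarrow> w \<in> carrier F \<Longrightarrow> P u \<Longrightarrow> P w \<Longrightarrow> P (\<lambda>x v. u x v + w x v)"
  shows "P u"
proof -
  let ?B = "SIGMA x:X. {s x..t x}"
  let ?r = "\<lambda>S x v. if (x, v) \<in> S then u x v else 0"
  have "finite S \<Longrightarrow> S \<subseteq> ?B \<Longrightarrow> P (?r S)" for S
  proof (induction S rule: finite_induct)
    case empty
    then show ?case using 0 by simp
  next
    case (insert b S)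
    obtain x p where b: "b = (x, p)" by (cases b)
    with insert have xp: "x \<in> X" "s x \<le> p" "p \<le> t x" by auto
    have "?r S \<in> carrier F" using u by (simp add: mem_F)
    then have "P (\<lambda>y v. ?r S y v + single x p (u x p) y v)"
      using insert.prems by (intro add insert.IH single[OF xp] single_mem[OF xp]) auto
    moreover have "(\<lambda>y v. ?r S y v + single x p (u x p) y v) = ?r (insert b S)"
      using insert(2) b by (auto simp: fun_eq_iff single_def)
    ultimately show ?case by (simp only:)
  qed
  moreover have "finite ?B" using finite_X by auto
  ultimately have "P (?r ?B)" by blast
  moreover have "?r ?B = u"
    using F_eq_0[OF u] by (intro ext) simp
  ultimately show ?thesis by (simp only:)
qed

text \<open>The longest path acts nontrivially only on a bar that contains both end vertices.
  Without such a bar it acts like the zero matrix.\<close>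

lemma full_bar_if_LT_faithful:
  assumes n: "n \<ge> 1"
    and inj: "\<And>A B. A \<in> carrier (LT n) \<Longrightarrow> B \<in> carrier (LT n) \<Longrightarrow>
      (\<And>u. u \<in> carrier F \<Longrightarrow> A \<odot>\<^bsub>F\<^esub> u = B \<odot>\<^bsub>F\<^esub> u) \<Longrightarrow> A = B"
  shows "\<exists>x\<in>X. s x = 0 \<and> t x = n - 1"
proof (rule ccontr)
  assume no: "\<not> ?thesis"
  have "(munit n (n - 1) 0 :: 'a mat) = 0\<^sub>m n n"
  proof (rule inj)
    show "(munit n (n - 1) 0 :: 'a mat) \<in> carrier (LT n)" by (simp add: munit_LT)
    show "(0\<^sub>m n n :: 'a mat) \<in> carrier (LT n)" by (auto simp: mem_LT)
    fix u assume u: "u \<in> carrier F"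
    have "(munit n (n - 1) 0 \<odot>\<^bsub>F\<^esub> u) x v = 0" for x v
    proof -
      have "u x 0 = 0" if "x \<in> X" "n - 1 \<le> t x"
      proof -
        have "t x = n - 1" using that less[of x] by auto
        then have "s x \<noteq> 0" using no that by auto
        then show ?thesis using F_eq_0[OF u] by simp
      qed
      then show ?thesis using n by (simp add: F_smult_munit)
    qed
    moreover have "(0\<^sub>m n n \<odot>\<^bsub>F\<^esub> u) x v = 0" for x v
    proof -
      have "(\<Sum>p<n. (0\<^sub>m n n) $$ (v, p) * u x p) = 0" if "x \<in> X" "v \<le> t x"
        using that less[of x] by (intro sum.neutral) auto
      then show ?thesis by (simp add: F_smult)
    qed
    ultimately show "munit n (n - 1) 0 \<odot>\<^bsub>F\<^esub> u = 0\<^sub>m n n \<odot>\<^bsub>F\<^esub> u" by (simp add: fun_eq_iff)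
  qed
  then have "(munit n (n - 1) 0 :: 'a mat) $$ (n - 1, 0) = 0\<^sub>m n n $$ (n - 1, 0)" by simp
  then show False using n by (simp add: munit_def)
qed

section \<open>Homomorphisms between bars, and the necessity of the cohook conditions\<close>

lemma endo_smult: "lmod_endo (LT n) F f \<Longrightarrow> A \<in> carrier (LT n) \<Longrightarrow> u \<in> carrier F \<Longrightarrow>
    f (A \<odot>\<^bsub>F\<^esub> u) = A \<odot>\<^bsub>F\<^esub> f u"
  by (simp add: lmod_endo_def)

lemma endo_mem: "lmod_endo (LT n) F f \<Longrightarrow> u \<in> carrier F \<Longrightarrow> f u \<in> carrier F"
  by (simp add: lmod_endo_def)

lemma endo_zero:
  assumes "lmod_endo (LT n) F f"
  shows "f (\<lambda>x v. 0) = (\<lambda>x v. 0)"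
proof -
  have 0: "(\<lambda>x v. 0) \<in> carrier F" by (simp add: mem_F)
  have "f ((\<lambda>x v. 0) \<oplus>\<^bsub>F\<^esub> (\<lambda>x v. 0)) = f (\<lambda>x v. 0) \<oplus>\<^bsub>F\<^esub> f (\<lambda>x v. 0)"
    using assms 0 unfolding lmod_endo_def by blast
  then have "f (\<lambda>x v. 0) = (\<lambda>y v. f (\<lambda>x v. 0) y v + f (\<lambda>x v. 0) y v)"
    unfolding F_simps by (simp only: add_0)
  from add_cancel_right_right[THEN iffD1, OF fun_cong[OF fun_cong[OF this]]] show ?thesis
    by (intro ext)
qed

text \<open>The vector at \<open>q\<close> is the translate of the vector at \<open>p\<close> along
  the path between them, and \<open>f\<close> commutes with this path.\<close>

lemma endo_single_transfer:
  assumes f: "lmod_endo (LT n) F f" and x: "x \<in> X" "s x \<le> p" "p \<le> q" "q \<le> t x"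
  shows "f (single x q c) y v =
    (if y \<in> X \<and> s y \<le> v \<and> v \<le> t y \<and> v = q then f (single x p c) y p else 0)"
proof -
  have p: "p < n" using x less[of x] by simp
  have mem: "single x p c \<in> carrier F" using x by (intro single_mem) auto
  have "single x q c = munit n q p \<odot>\<^bsub>F\<^esub> single x p c"
    using x by (intro ext) (auto simp: F_smult_munit[OF p] single_def)
  then have "f (single x q c) = munit n q p \<odot>\<^bsub>F\<^esub> f (single x p c)"
    using endo_smult[OF f munit_LT[OF x(3)] mem] by simp
  then show ?thesis by (simp add: F_smult_munit[OF p])
qed

text \<open>A value at \<open>p\<close> is the translate of the value at the start
  \<open>s x\<close>, so \<open>y\<close> must contain that vertex. The path to
  \<open>Suc (t x)\<close> kills the source, so \<open>y\<close> must not contain that one. Hence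
  bars map nontrivially only to bars that start and end no later.\<close>

lemma endo_single_nz:
  assumes f: "lmod_endo (LT n) F f" and x: "x \<in> X" "s x \<le> p" "p \<le> t x"
    and nz: "f (single x p c) y v \<noteq> 0"
  shows "v = p" "s y \<le> s x" "t y \<le> t x" "y \<in> X" "p \<le> t y"
proof -
  note tr = endo_single_transfer[OF f x(1)]
  have p: "p < n" using x less[of x] by simp
  have mem: "single x p c \<in> carrier F" using x by (intro single_mem) auto
  show vp: "v = p" and y: "y \<in> X" and pt: "p \<le> t y"
    using tr[of p p c y v] x nz by (auto split: if_splits)
  have "f (single x (s x) c) y (s x) \<noteq> 0"
    using tr[of "s x" p c y v] x nz by (auto split: if_splits)
  then show "s y \<le> s x"
    using F_eq_0[OF endo_mem[OF f single_mem[OF x(1) order_refl le[OF x(1)]]], of y "s x"] by (cases "s y \<le> s x") auto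
  show "t y \<le> t x"
  proof (rule ccontr)
    assume "\<not> t y \<le> t x"
    moreover have "s y \<le> p" using F_eq_0[OF endo_mem[OF f mem], of y p] nz vp by (cases "s y \<le> p") auto
    ultimately have *: "s y \<le> Suc (t x)" "Suc (t x) \<le> t y" "p \<le> Suc (t x)" using x by auto
    have "munit n (Suc (t x)) p \<odot>\<^bsub>F\<^esub> single x p c = (\<lambda>y v. 0)"
      by (intro ext) (auto simp: F_smult_munit[OF p] single_def)
    then have "munit n (Suc (t x)) p \<odot>\<^bsub>F\<^esub> f (single x p c) = (\<lambda>y v. 0)"
      using endo_smult[OF f munit_LT[OF *(3)] mem] endo_zero[OF f] by simp
    then have "(munit n (Suc (t x)) p \<odot>\<^bsub>F\<^esub> f (single x p c)) y (Suc (t x)) = 0" by simp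
    then show False using * y nz vp by (simp add: F_smult_munit[OF p])
  qed
qed

text \<open>The map \<open>\<phi>\<close> below is not induced by a matrix: the entry at
  \<open>(t x, s x)\<close> would have to be 1 because of the bar \<open>x\<close> and 0 because of
  the full bar \<open>z\<close>.\<close>

lemma cohook_if_bicommutant:
  assumes bi: "\<And>\<phi>. bicommutant (LT n) F \<phi> \<Longrightarrow>
      \<exists>A\<in>carrier (LT n). \<forall>u\<in>carrier F. \<phi> u = A \<odot>\<^bsub>F\<^esub> u"
    and z: "z \<in> X" "s z = 0" "t z = n - 1"
    and x: "x \<in> X" "(s x, t x) \<noteq> (0, n - 1)"
  shows "\<exists>y\<in>X. s y < s x \<and> t y = t x \<or> s y = s x \<and> t x < t y"
proof (rule ccontr)
  assume "\<not> ?thesis"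
  then have no: "\<And>y. y \<in> X \<Longrightarrow> t y = t x \<Longrightarrow> s x \<le> s y" "\<And>y. y \<in> X \<Longrightarrow> s y = s x \<Longrightarrow> t y \<le> t x"
    by (meson not_le)+
  define \<phi> :: "('i \<Rightarrow> nat \<Rightarrow> 'a) \<Rightarrow> 'i \<Rightarrow> nat \<Rightarrow> 'a" where
    "\<phi> = (\<lambda>u y v. if y \<in> X \<and> s y = s x \<and> t y = t x \<and> v = t x then u y (s x) else 0)"
  have sn: "s x < n" "t x < n" "s x \<le> t x" using le[OF x(1)] less[OF x(1)] by auto
  have "bicommutant (LT n) F \<phi>"
    unfolding bicommutant_def
  proof (intro conjI allI impI ballI)
    show "\<phi> u \<in> carrier F" for u using sn by (auto simp: \<phi>_def mem_F split: if_splits)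
    show "\<phi> (u \<oplus>\<^bsub>F\<^esub> w) = \<phi> u \<oplus>\<^bsub>F\<^esub> \<phi> w" for u w by (auto simp: \<phi>_def fun_eq_iff)
    fix f u assume f: "lmod_endo (LT n) F f" and "u \<in> carrier F"
    from this(2) show "\<phi> (f u) = f (\<phi> u)"
    proof (induction u rule: F_induct)
      case zero
      have "\<phi> (\<lambda>x v. 0) = (\<lambda>x v. 0)" by (simp add: \<phi>_def fun_eq_iff)
      then show ?case using endo_zero[OF f] by simp
    next
      case (add u w)
      have mem: "\<phi> u \<in> carrier F" for u using sn by (auto simp: \<phi>_def mem_F split: if_splits)
      have plus: "\<phi> (\<lambda>x v. u x v + w x v) = (\<lambda>x v. \<phi> u x v + \<phi> w x v)" for u w
        by (auto simp: \<phi>_def fun_eq_iff)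
      have fplus: "f (\<lambda>x v. u x v + w x v) = (\<lambda>x v. f u x v + f w x v)"
        if "u \<in> carrier F" "w \<in> carrier F" for u w
        using f that unfolding lmod_endo_def by simp
      show ?case
        using add mem by (simp add: plus fplus)
    next
      case (single a p c)
      note nz = endo_single_nz[OF f single]
      note tr = endo_single_transfer[OF f single(1)]
      show ?case
      proof (intro ext)
        fix y v
        show "\<phi> (f (single a p c)) y v = f (\<phi> (single a p c)) y v"
        proof (cases "p = s x \<and> s a = s x \<and> t a = t x")
          \<comment> \<open>The vector sits at the start of a copy of the bar \<open>x\<close>. A
            bar hit by \<open>f\<close> that still contains vertex \<open>t x\<close> ends there,
            and as the first half of the cohook is missed, it also starts at
            \<open>s x\<close>.\<close>
          case True
          then have "\<phi> (single a p c) = single a (t x) c"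
            using single by (auto simp: fun_eq_iff \<phi>_def single_def)
          then have *: "f (\<phi> (single a p c)) y v =
              (if y \<in> X \<and> s y \<le> v \<and> v \<le> t y \<and> v = t x then f (single a p c) y p else 0)"
            using tr[of p "t x" c y v] single True by simp
          have **: "\<phi> (f (single a p c)) y v =
              (if y \<in> X \<and> s y = s x \<and> t y = t x \<and> v = t x then f (single a p c) y p else 0)"
            using True by (simp add: \<phi>_def)
          show ?thesis
          proof (cases "f (single a p c) y p = 0")
            case False
            then have "(y \<in> X \<and> s y = s x \<and> t y = t x \<and> v = t x) \<longleftrightarrow>
                (y \<in> X \<and> s y \<le> v \<and> v \<le> t y \<and> v = t x)"
              using True nz[OF False] no(1)[of y] le[of y] by (metis le_antisym)
            then show ?thesis unfolding * ** by simp
          qed (simp add: * **)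
        next
          \<comment> \<open>Nothing else is mapped to vertex \<open>s x\<close> of a copy of the
            bar: the source would start at \<open>s x\<close> and end no earlier than
            \<open>t x\<close>, and the second half of the cohook is missed.\<close>
          case False
          then have "\<phi> (single a p c) = (\<lambda>x v. 0)"
            by (auto simp: fun_eq_iff \<phi>_def single_def)
          moreover have "\<phi> (f (single a p c)) y v = 0"
          proof (rule ccontr)
            assume "\<phi> (f (single a p c)) y v \<noteq> 0"
            then have y: "s y = s x" "t y = t x" and f0: "f (single a p c) y (s x) \<noteq> 0"
              by (auto simp: \<phi>_def split: if_splits)
            show False
              using nz[OF f0] y no(2)[OF single(1)] single False by auto
          qed
          ultimately show ?thesis using endo_zero[OF f] by simp
        qed
      qed
    qed
  qed
  then obtain A where A: "\<forall>u\<in>carrier F. \<phi> u = A \<odot>\<^bsub>F\<^esub> u" using bi by blast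
  have "\<phi> (single x (s x) 1) x (t x) = A $$ (t x, s x)"
    using A single_mem[OF x(1)] sn x by (simp add: F_smult_single)
  moreover have "\<phi> (single z (s x) 1) z (t x) = A $$ (t x, s x)"
    using A single_mem[OF z(1)] sn z by (simp add: F_smult_single)
  ultimately show False using x z by (auto simp: \<phi>_def single_def split: if_splits)
qed


text \<open>If no bar starts at \<open>Suc i\<close> or ends at \<open>i\<close>, every bar contains
  both vertices or neither, so the arrow from \<open>i\<close> to \<open>Suc i\<close> has an
  inverse \<open>\<phi>\<close> that commutes with all endomorphisms. A matrix inducing
  \<open>\<phi>\<close> would have a nonzero entry above the diagonal.\<close>

lemma virtual_cohook_if_bicommutant:
  assumes bi: "\<And>\<phi>. bicommutant (LT n) F \<phi> \<Longrightarrow>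
      \<exists>A\<in>carrier (LT n). \<forall>u\<in>carrier F. \<phi> u = A \<odot>\<^bsub>F\<^esub> u"
    and z: "z \<in> X" "s z = 0" "t z = n - 1"
    and i: "Suc i < n"
  shows "\<exists>y\<in>X. s y = Suc i \<or> t y = i"
proof (rule ccontr)
  assume no: "\<not> ?thesis"
  define \<phi> :: "('i \<Rightarrow> nat \<Rightarrow> 'a) \<Rightarrow> 'i \<Rightarrow> nat \<Rightarrow> 'a" where
    "\<phi> = (\<lambda>u y v. if v = i then u y (Suc i) else 0)"
  have "bicommutant (LT n) F \<phi>"
    unfolding bicommutant_def
  proof (intro conjI allI impI ballI)
    fix u assume u: "u \<in> carrier F"
    show mem: "\<phi> u \<in> carrier F"
      unfolding mem_F
    proof (intro allI impI)
      fix y v assume "\<phi> u y v \<noteq> 0"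
      then have "v = i" "u y (Suc i) \<noteq> 0" by (auto simp: \<phi>_def split: if_splits)
      moreover have "y \<in> X" "s y \<le> Suc i" "Suc i \<le> t y"
        using calculation(2) u unfolding mem_F by blast+
      moreover have "s y \<noteq> Suc i" using no calculation(3) by blast
      ultimately show "y \<in> X \<and> s y \<le> v \<and> v \<le> t y" by auto
    qed
    show "\<phi> (u \<oplus>\<^bsub>F\<^esub> w) = \<phi> u \<oplus>\<^bsub>F\<^esub> \<phi> w" for w by (auto simp: \<phi>_def fun_eq_iff)
    fix f assume f: "lmod_endo (LT n) F f"
    \<comment> \<open>The arrow undoes \<open>\<phi>\<close>. Applying \<open>f\<close> to this
      gives an equation that determines \<open>f (\<phi> u)\<close> at vertex \<open>i\<close>,
      where the arrow is injective.\<close>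
    have "munit n (Suc i) i \<odot>\<^bsub>F\<^esub> \<phi> u = munit n (Suc i) (Suc i) \<odot>\<^bsub>F\<^esub> u"
      using i by (auto simp: fun_eq_iff F_smult_munit \<phi>_def)
    then have 1: "munit n (Suc i) i \<odot>\<^bsub>F\<^esub> f (\<phi> u) = munit n (Suc i) (Suc i) \<odot>\<^bsub>F\<^esub> f u"
      using endo_smult[OF f munit_LT mem, of i "Suc i"] endo_smult[OF f munit_LT u, of "Suc i" "Suc i"]
      by simp
    have 2: "f (\<phi> u) y i = f u y (Suc i)" if "y \<in> X" "s y \<le> Suc i" "Suc i \<le> t y" for y
      using fun_cong[OF fun_cong[OF 1], of y "Suc i"] that i by (simp add: F_smult_munit)
    \<comment> \<open>Being fixed by the idempotent at \<open>i\<close> is preserved by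
      \<open>f\<close>, so \<open>f (\<phi> u)\<close> has no coordinates at other vertices.\<close>
    have "\<phi> u = munit n i i \<odot>\<^bsub>F\<^esub> \<phi> u"
    proof (intro ext)
      fix y v
      show "\<phi> u y v = (munit n i i \<odot>\<^bsub>F\<^esub> \<phi> u) y v"
        using F_eq_0[OF mem, of y v] i by (cases "v = i") (auto simp: F_smult_munit \<phi>_def)
    qed
    then have 3: "f (\<phi> u) = munit n i i \<odot>\<^bsub>F\<^esub> f (\<phi> u)"
      using endo_smult[OF f munit_LT mem, of i i] by simp
    have 4: "f (\<phi> u) y v = 0" if "v \<noteq> i" for y v
      using fun_cong[OF fun_cong[OF 3], of y v] that i by (simp add: F_smult_munit)
    have 5: "f (\<phi> u) y i = f u y (Suc i)" for y
    proof (cases "y \<in> X \<and> s y \<le> Suc i \<and> Suc i \<le> t y")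
      case False
      then have "\<not> (y \<in> X \<and> s y \<le> i \<and> i \<le> t y)"
        using no by (metis le_SucI le_antisym not_less_eq_eq)
      then show ?thesis
        using F_eq_0[OF endo_mem[OF f u]] F_eq_0[OF endo_mem[OF f mem]] False by metis
    qed (use 2 in auto)
    show "\<phi> (f u) = f (\<phi> u)"
    proof (intro ext)
      fix y v
      have "\<phi> (f u) y v = (if v = i then f u y (Suc i) else 0)" by (simp add: \<phi>_def)
      then show "\<phi> (f u) y v = f (\<phi> u) y v" using 4 5 by (cases "v = i") simp_all
    qed
  qed
  then obtain A where A: "A \<in> carrier (LT n)" "\<forall>u\<in>carrier F. \<phi> u = A \<odot>\<^bsub>F\<^esub> u" using bi by blast
  have "\<phi> (single z (Suc i) 1) z i = A $$ (i, Suc i)"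
    using A(2) single_mem[OF z(1)] z i by (simp add: F_smult_single)
  moreover have "A $$ (i, Suc i) = 0" using A(1) i by (simp add: mem_LT)
  ultimately show False by (simp add: \<phi>_def single_def)
qed

section \<open>Faithfulness on the full bar, and the sufficiency of the conditions\<close>

lemma LT_faithful:
  assumes z: "z \<in> X" "s z = 0" "t z = n - 1"
    and AB: "A \<in> carrier (LT n)" "B \<in> carrier (LT n)" "\<And>u. u \<in> carrier F \<Longrightarrow> A \<odot>\<^bsub>F\<^esub> u = B \<odot>\<^bsub>F\<^esub> u"
  shows "A = B"
proof (rule eq_matI)
  fix q p assume "q < dim_row B" "p < dim_col B"
  then have qp: "q < n" "p < n" using AB by (auto simp: mem_LT)
  then have "(A \<odot>\<^bsub>F\<^esub> single z p 1) z q = (B \<odot>\<^bsub>F\<^esub> single z p 1) z q"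
    using AB(3)[OF single_mem[OF z(1)]] z by simp
  moreover have "s z \<le> q" "q \<le> t z" using qp z by simp_all
  ultimately show "A $$ (q, p) = B $$ (q, p)" using qp z(1) by (simp add: F_smult_single)
qed (use AB in \<open>auto simp: mem_LT\<close>)

text \<open>Scaling commutes with the action. It follows that every map in the bicommutant is linear
  over the field.\<close>

lemma scalar_endo: "lmod_endo (LT n) F (\<lambda>u x v. c * u x v)"
  unfolding lmod_endo_def
  by (auto simp: mem_F fun_eq_iff F_smult distrib_left sum_distrib_left mult.left_commute)

text \<open>
  The map from the bar \<open>x\<close> to the bar \<open>y\<close> given by the identity on their overlap; it is a homomorphism
  when \<open>s y \<le> s x\<close> and \<open>t y \<le> t x\<close>.
\<close>

definition bar_hom :: "'i \<Rightarrow> 'i \<Rightarrow> ('i \<Rightarrow> nat \<Rightarrow> 'a) \<Rightarrow> 'i \<Rightarrow> nat \<Rightarrow> 'a" where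
  "bar_hom x y u = (\<lambda>w v. if w = y \<and> s x \<le> v \<and> v \<le> t y then u x v else 0)"

text \<open>Restricting the sum over \<open>p\<close> to the overlap changes nothing: before
  \<open>s x\<close> the vector vanishes, and after \<open>t y\<close> the entry
  \<open>A $$ (q, p)\<close> does, because \<open>q \<le> t y\<close> and \<open>A\<close> is lower
  triangular.\<close>

lemma bar_hom_endo:
  assumes x: "x \<in> X" and y: "y \<in> X" and xy: "s y \<le> s x" "t y \<le> t x"
  shows "lmod_endo (LT n) F (bar_hom x y)"
  unfolding lmod_endo_def
proof (intro conjI ballI)
  show "bar_hom x y u \<in> carrier F" for u
    using y xy by (auto simp: mem_F bar_hom_def split: if_splits)
  show "bar_hom x y (u \<oplus>\<^bsub>F\<^esub> w) = bar_hom x y u \<oplus>\<^bsub>F\<^esub> bar_hom x y w" for u w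
    by (auto simp: fun_eq_iff bar_hom_def)
  fix A :: "'a mat" and u assume A: "A \<in> carrier (LT n)" and u: "u \<in> carrier F"
  have "(if s x \<le> q then \<Sum>p<n. A $$ (q, p) * u x p else 0) =
      (\<Sum>p<n. A $$ (q, p) * (if s x \<le> p \<and> p \<le> t y then u x p else 0))" if q: "q \<le> t y" for q
  proof -
    have qn: "q < n" using q less[OF y] by simp
    have "(if s x \<le> q then A $$ (q, p) * u x p else 0) =
        A $$ (q, p) * (if s x \<le> p \<and> p \<le> t y then u x p else 0)" if "p < n" for p
    proof (cases "q < p")
      case True
      then show ?thesis using A qn that by (simp add: mem_LT)
    next
      case False
      then show ?thesis using q F_eq_0[OF u, of x p] by auto
    qed
    then have "(\<Sum>p<n. if s x \<le> q then A $$ (q, p) * u x p else 0) =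
        (\<Sum>p<n. A $$ (q, p) * (if s x \<le> p \<and> p \<le> t y then u x p else 0))"
      by (intro sum.cong) auto
    then show ?thesis by (cases "s x \<le> q") (simp_all only: if_True if_False sum.neutral_const)
  qed
  note * = this
  show "bar_hom x y (A \<odot>\<^bsub>F\<^esub> u) = A \<odot>\<^bsub>F\<^esub> bar_hom x y u"
  proof (intro ext)
    fix w q
    show "bar_hom x y (A \<odot>\<^bsub>F\<^esub> u) w q = (A \<odot>\<^bsub>F\<^esub> bar_hom x y u) w q"
    proof (cases "w = y \<and> q \<le> t y")
      case True
      then have "bar_hom x y (A \<odot>\<^bsub>F\<^esub> u) w q = (if s x \<le> q then \<Sum>p<n. A $$ (q, p) * u x p else 0)"
        using x xy by (simp add: bar_hom_def F_smult)
      moreover have "(A \<odot>\<^bsub>F\<^esub> bar_hom x y u) w q = (if s y \<le> q then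
          \<Sum>p<n. A $$ (q, p) * (if s x \<le> p \<and> p \<le> t y then u x p else 0) else 0)"
        using True y by (simp add: bar_hom_def F_smult)
      ultimately show ?thesis using *[of q] True xy by (cases "s y \<le> q") simp_all
    next
      case False
      then show ?thesis by (cases "w = y") (simp_all add: bar_hom_def F_smult)
    qed
  qed
qed

lemma bar_hom_single:
  "bar_hom x y (single x p c) = (if s x \<le> p \<and> p \<le> t y then single y p c else (\<lambda>w v. 0))"
  by (auto simp: bar_hom_def single_def fun_eq_iff)

text \<open>The inclusions and projections between bars make the coefficient matrices of
  \<open>\<phi>\<close> agree where they overlap. The invariance of their images and kernels under
  \<open>\<phi>\<close> gives the zeros above the diagonal.\<close>

lemma LT_if_bicommutant:
  assumes z: "z \<in> X" "s z = 0" "t z = n - 1"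
    and fb1: "\<And>x. x \<in> X \<Longrightarrow> (s x, t x) \<noteq> (0, n - 1) \<Longrightarrow>
      \<exists>y\<in>X. s y < s x \<and> t y = t x \<or> s y = s x \<and> t x < t y"
    and fb2: "\<And>i. Suc i < n \<Longrightarrow> \<exists>y\<in>X. s y = Suc i \<or> t y = i"
    and \<phi>: "bicommutant (LT n) F \<phi>"
  shows "\<exists>A\<in>carrier (LT n). \<forall>u\<in>carrier F. \<phi> u = A \<odot>\<^bsub>F\<^esub> u"
proof -
  have \<phi>_mem: "\<phi> u \<in> carrier F" if "u \<in> carrier F" for u
    using \<phi> that by (simp add: bicommutant_def)
  have \<phi>_add: "\<phi> (\<lambda>x v. u x v + w x v) = (\<lambda>x v. \<phi> u x v + \<phi> w x v)"
    if "u \<in> carrier F" "w \<in> carrier F" for u w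
    using \<phi> that by (simp add: bicommutant_def)
  have \<phi>_endo: "\<phi> (f u) = f (\<phi> u)" if "lmod_endo (LT n) F f" "u \<in> carrier F" for f u
    using \<phi> that by (simp add: bicommutant_def)
  have \<phi>_scalar: "\<phi> (\<lambda>x v. c * u x v) = (\<lambda>x v. c * \<phi> u x v)" if "u \<in> carrier F" for u c
    using \<phi>_endo[OF scalar_endo that] .
  have 0: "(\<lambda>x v. 0) \<in> carrier F" by (simp add: mem_F)
  have \<phi>_zero: "\<phi> (\<lambda>x v. 0) = (\<lambda>x v. 0)"
    using \<phi>_scalar[OF 0, of 0] by simp
  \<comment> \<open>A member of a cohook starts earlier or ends later, so \<open>m\<close> drops,
    and inductions on \<open>m\<close> climb along cohooks.\<close>
  define m where "m x = s x + (n - t x)" for x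
  define co where "co x q p = \<phi> (single x p 1) x q" for x q p
  \<comment> \<open>Both sides are coefficients at vertex \<open>q\<close> of the bar
    \<open>y\<close>: \<open>\<phi>\<close> and \<open>bar_hom x y\<close> are applied in the two
    possible orders to the basis vector of \<open>x\<close> at \<open>p\<close>.\<close>
  have hom: "(if s x \<le> p \<and> p \<le> t y then co y q p else 0) =
      (if s x \<le> q \<and> q \<le> t y then co x q p else 0)"
    if "x \<in> X" "y \<in> X" "s y \<le> s x" "t y \<le> t x" "s x \<le> p" "p \<le> t x" for x y p q
  proof -
    have "\<phi> (bar_hom x y (single x p 1)) = bar_hom x y (\<phi> (single x p 1))"
      using \<phi>_endo[OF bar_hom_endo single_mem] that by simp
    from fun_cong[OF fun_cong[OF this, of y], of q] show ?thesis
      unfolding bar_hom_single by (auto simp: \<phi>_zero co_def bar_hom_def)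
  qed
  have coz: "co x q p = co z q p" if "x \<in> X" "s x \<le> p" "p \<le> t x" "s x \<le> q" "q \<le> t x" for x q p
    using that
  proof (induction "m x" arbitrary: x rule: less_induct)
    case less
    note x = less.prems
    show ?case
    proof (cases "(s x, t x) = (0, n - 1)")
      case True
      then show ?thesis using hom[of x z p q] x z by simp
    next
      case False
      then obtain y where y: "y \<in> X" "s y < s x \<and> t y = t x \<or> s y = s x \<and> t x < t y"
        using fb1 x(1) by blast
      have "m y < m x" using y barcode.less[OF barcode_axioms y(1)] by (auto simp: m_def)
      then have IH: "co y q p = co z q p" using less.hyps[of y] y x by auto
      from y(2) show ?thesis
      proof
        \<comment> \<open>Here \<open>x\<close> embeds into \<open>y\<close>; in the other case
          \<open>y\<close> maps onto \<open>x\<close>.\<close>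
        assume "s y < s x \<and> t y = t x"
        then show ?thesis using hom[of x y p q] IH x y(1) by simp
      next
        assume "s y = s x \<and> t x < t y"
        then show ?thesis using hom[of y x p q] IH x y(1) by simp
      qed
    qed
  qed
  \<comment> \<open>Climb until the bar contains \<open>q\<close>. It then contains the previous bar
    as a submodule invariant under \<open>\<phi>\<close>, and no coefficient leads from this
    submodule to the earlier vertex \<open>q\<close>.\<close>
  have L1: "co z q p = 0" if "b \<in> X" "q < s b" "s b \<le> p" "p \<le> t b" for b q p
    using that
  proof (induction "m b" arbitrary: b rule: less_induct)
    case less
    note b = less.prems
    obtain c where c: "c \<in> X" "s c < s b \<and> t c = t b \<or> s c = s b \<and> t b < t c"
      using fb1[OF b(1)] b(2) by auto
    have "m c < m b" using c barcode.less[OF barcode_axioms c(1)] by (auto simp: m_def)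
    then have IH: "co z q p = 0" if "q < s c" using less.hyps[of c] c b that by auto
    show ?case
    proof (cases "q < s c")
      case False
      then have "co c q p = 0" using hom[of b c p q] b c by auto
      then show ?thesis using coz[of c p q] c b False by auto
    qed (fact IH)
  qed
  \<comment> \<open>Dually, climb until the bar contains \<open>p\<close>. It then maps onto the
    previous bar with a kernel that is invariant under \<open>\<phi>\<close> and contains the vector
    at \<open>p\<close>.\<close>
  have L2: "co z q p = 0" if "b \<in> X" "s b \<le> q" "q \<le> t b" "t b < p" "p < n" for b q p
    using that
  proof (induction "m b" arbitrary: b rule: less_induct)
    case less
    note b = less.prems
    have "(s b, t b) \<noteq> (0, n - 1)" using b(4,5) by auto
    then obtain c where c: "c \<in> X" "s c < s b \<and> t c = t b \<or> s c = s b \<and> t b < t c"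
      using fb1[OF b(1)] by blast
    have "m c < m b" using c barcode.less[OF barcode_axioms c(1)] by (auto simp: m_def)
    then have IH: "co z q p = 0" if "t c < p" using less.hyps[of c] c b that by auto
    show ?case
    proof (cases "t c < p")
      case False
      then have "co c q p = 0" using hom[of c b p q] b c by auto
      then show ?thesis using coz[of c p q] c b False by auto
    qed (fact IH)
  qed
  \<comment> \<open>Here \<open>q\<close> lies before the bar and \<open>p\<close> is the first
    vertex after it. Moving the end takes \<open>p\<close> into the new bar, where \<open>L1\<close>
    applies. Moving the start keeps the end, and once \<open>q\<close> is in the bar,
    \<open>L2\<close> applies.\<close>
  have L3: "co z q p = 0" if "b \<in> X" "q < s b" "Suc (t b) = p" "p < n" for b q p
    using that
  proof (induction "m b" arbitrary: b rule: less_induct)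
    case less
    note b = less.prems
    obtain c where c: "c \<in> X" "s c < s b \<and> t c = t b \<or> s c = s b \<and> t b < t c"
      using fb1[OF b(1)] b(2) by auto
    have "m c < m b" using c barcode.less[OF barcode_axioms c(1)] by (auto simp: m_def)
    then have IH: "co z q p = 0" if "q < s c" "t c = t b" using less.hyps[of c] c b that by auto
    show ?case
    proof (cases "t c = t b")
      case True
      show ?thesis
      proof (cases "q < s c")
        case False
        then show ?thesis using L2[of c q p] True c b le[OF b(1)] by auto
      qed (use IH True in auto)
    next
      case False
      then show ?thesis using L1[of c q p] c b le[OF b(1)] by auto
    qed
  qed
  \<comment> \<open>The virtual cohook between the vertices \<open>p - 1\<close> and
    \<open>p\<close> provides a bar that starts at \<open>p\<close> or ends at
    \<open>p - 1\<close>.\<close>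
  have lower: "co z q p = 0" if qp: "q < p" "p < n" for q p
  proof -
    obtain i where i: "p = Suc i" using qp by (cases p) auto
    then obtain y where y: "y \<in> X" "s y = p \<or> Suc (t y) = p" using fb2[of i] qp by auto
    show ?thesis
    proof (cases "s y = p")
      case True
      then show ?thesis using L1[of y q p] y qp le[OF y(1)] by simp
    next
      case False
      then have "Suc (t y) = p" using y by simp
      then show ?thesis using L2[of y q p] L3[of y q p] y(1) qp by (cases "q < s y") auto
    qed
  qed
  define A where "A = mat n n (\<lambda>(q, p). co z q p)"
  have A: "A \<in> carrier (LT n)" using lower by (auto simp: mem_LT A_def)
  have "\<phi> u = A \<odot>\<^bsub>F\<^esub> u" if "u \<in> carrier F" for u
    using that
  proof (induction u rule: F_induct)
    case zero
    show ?case by (auto simp: \<phi>_zero fun_eq_iff F_smult)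
  next
    case (add u w)
    then show ?case using F_smult_r_distr[of A u w] by (simp add: \<phi>_add)
  next
    case (single x p c)
    note mem = single_mem[OF single]
    have pn: "p < n" using single less[of x] by simp
    show ?case
    proof (intro ext)
      fix y q
      have "single x p c = (\<lambda>y v. c * single x p 1 y v)" by (auto simp: single_def fun_eq_iff)
      then have 1: "\<phi> (single x p c) = (\<lambda>y v. c * \<phi> (single x p 1) y v)"
        using \<phi>_scalar[OF mem] by metis
      \<comment> \<open>\<open>bar_hom x x\<close> is the projection onto the bar \<open>x\<close>,
        so \<open>\<phi>\<close> maps this bar to itself.\<close>
      have "bar_hom x x (single x p 1) = single x p 1" using single by (simp add: bar_hom_single)
      then have 2: "\<phi> (single x p 1) = bar_hom x x (\<phi> (single x p 1))"
        using \<phi>_endo[OF bar_hom_endo mem] single(1) by (metis order_refl)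
      show "\<phi> (single x p c) y q = (A \<odot>\<^bsub>F\<^esub> single x p c) y q"
      proof (cases "y = x \<and> s x \<le> q \<and> q \<le> t x")
        case True
        then have "\<phi> (single x p 1) x q = A $$ (q, p)"
          using coz[OF single, of q] pn less[OF single(1)] by (simp add: A_def co_def)
        then show ?thesis using True pn single(1) by (simp add: 1 F_smult_single)
      next
        case False
        then have "\<phi> (single x p 1) y q = 0"
          using fun_cong[OF fun_cong[OF 2], of y q] by (auto simp: bar_hom_def)
        then show ?thesis using False pn by (auto simp: 1 F_smult_single)
      qed
    qed
  qed
  then show ?thesis using A by blast
qed

text \<open>The two virtual cohooks at the ends contain the full bar, so only those between
  neighbouring vertices \<open>i\<close> and \<open>Suc i\<close> are listed.\<close>

lemma faithfully_balanced_F_iff: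
  assumes n: "n \<ge> 1" and F: "left_module (LT n) F"
  shows "faithfully_balanced (LT n) F \<longleftrightarrow>
    (\<exists>z\<in>X. s z = 0 \<and> t z = n - 1) \<and>
    (\<forall>x\<in>X. (s x, t x) \<noteq> (0, n - 1) \<longrightarrow> (\<exists>y\<in>X. s y < s x \<and> t y = t x \<or> s y = s x \<and> t x < t y)) \<and>
    (\<forall>i. Suc i < n \<longrightarrow> (\<exists>y\<in>X. s y = Suc i \<or> t y = i))" (is "_ \<longleftrightarrow> ?rhs")
proof -
  have "faithfully_balanced (LT n) F \<longleftrightarrow>
    (\<forall>a\<in>carrier (LT n). \<forall>b\<in>carrier (LT n). (\<forall>x\<in>carrier F. a \<odot>\<^bsub>F\<^esub> x = b \<odot>\<^bsub>F\<^esub> x) \<longrightarrow> a = b) \<and>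
    (\<forall>\<phi>. bicommutant (LT n) F \<phi> \<longrightarrow> (\<exists>a\<in>carrier (LT n). \<forall>x\<in>carrier F. \<phi> x = a \<odot>\<^bsub>F\<^esub> x))"
    (is "_ \<longleftrightarrow> ?inj \<and> ?surj")
    by (rule left_module.faithfully_balanced_iff[OF F])
  moreover have "?inj \<and> ?surj \<longleftrightarrow> ?rhs"
  proof
    assume *: "?inj \<and> ?surj"
    then have bi: "\<And>\<phi>. bicommutant (LT n) F \<phi> \<Longrightarrow> \<exists>A\<in>carrier (LT n). \<forall>u\<in>carrier F. \<phi> u = A \<odot>\<^bsub>F\<^esub> u"
      by blast
    have ex: "\<exists>z\<in>X. s z = 0 \<and> t z = n - 1"
      by (rule full_bar_if_LT_faithful[OF n]) (use * in blast)
    then obtain z where z: "z \<in> X" "s z = 0" "t z = n - 1" by blast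
    show ?rhs
      using ex cohook_if_bicommutant[OF bi z] virtual_cohook_if_bicommutant[OF bi z] by blast
  next
    assume r: ?rhs
    then obtain z where z: "z \<in> X" "s z = 0" "t z = n - 1" by blast
    have ?inj using LT_faithful[OF z] by blast
    moreover have ?surj
    proof (intro allI impI)
      fix \<phi> assume "bicommutant (LT n) F \<phi>"
      then show "\<exists>A\<in>carrier (LT n). \<forall>u\<in>carrier F. \<phi> u = A \<odot>\<^bsub>F\<^esub> u"
        using r by (intro LT_if_bicommutant[OF z]) blast+
    qed
    ultimately show "?inj \<and> ?surj" by blast
  qed
  ultimately show ?thesis by simp
qed

end

section \<open>Interval summands\<close>

lemma interval_simps [simp]:
  "zero (interval_module n i j) = 0\<^sub>v n" "add (interval_module n i j) = (+)"
  by (simp_all add: interval_module_def)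

lemma mem_interval:
  "v \<in> carrier (interval_module n (Suc i) (Suc j)) \<longleftrightarrow>
    v \<in> carrier_vec n \<and> (\<forall>p<n. v $ p \<noteq> 0 \<longrightarrow> i \<le> p \<and> p \<le> j)"
  by (simp add: interval_module_def)

lemma interval_smult:
  assumes "A \<in> carrier_mat n n" "v \<in> carrier_vec n"
  shows "A \<odot>\<^bsub>interval_module n (Suc i) (Suc j)\<^esub> v =
    vec n (\<lambda>p. if i \<le> p \<and> p \<le> j then \<Sum>r<n. A $$ (p, r) * v $ r else 0)"
  using assms
  by (auto simp: interval_module_def scalar_prod_def lessThan_atLeast0 intro!: eq_vecI sum.cong)

lemma interval_add_closed:
  assumes "v \<in> carrier (interval_module n (Suc i) (Suc j))"
    and "w \<in> carrier (interval_module n (Suc i) (Suc j))"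
  shows "v + w \<in> carrier (interval_module n (Suc i) (Suc j))"
  using assms by (auto simp: mem_interval)

lemma interval_smult_closed:
  assumes "v \<in> carrier (interval_module n (Suc i) (Suc j))" and "A \<in> carrier (LT n)"
  shows "A \<odot>\<^bsub>interval_module n (Suc i) (Suc j)\<^esub> v \<in> carrier (interval_module n (Suc i) (Suc j))"
  using assms by (auto simp: mem_interval mem_LT interval_smult split: if_splits)

lemma munit_carrier: "munit n q p \<in> carrier_mat n n"
  by (simp add: munit_def)

lemma interval_smult_munit:
  assumes "v \<in> carrier_vec n" "p < n"
  shows "munit n q p \<odot>\<^bsub>interval_module n (Suc i) (Suc j)\<^esub> v =
    vec n (\<lambda>r. if i \<le> r \<and> r \<le> j \<and> r = q then v $ p else 0)"
proof -
  have "(\<Sum>l<n. munit n q p $$ (r, l) * v $ l) = (if r = q then v $ p else 0)" if "r < n" for r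
  proof -
    have "(\<Sum>l<n. munit n q p $$ (r, l) * v $ l) = (\<Sum>l<n. if l = p then (if r = q then v $ p else 0) else 0)"
      using that by (intro sum.cong) (auto simp: munit_def)
    then show ?thesis using assms by (simp add: sum.delta)
  qed
  then show ?thesis
    using assms by (subst interval_smult) (auto simp: munit_carrier intro!: eq_vecI)
qed

context barcode
begin

lemma F_abelian_group: "abelian_group F"
proof (rule abelian_groupI)
  fix u assume u: "u \<in> carrier F"
  show "\<exists>w\<in>carrier F. w \<oplus>\<^bsub>F\<^esub> u = \<zero>\<^bsub>F\<^esub>"
    by (rule bexI[of _ "\<lambda>x v. - u x v"]) (use u in \<open>auto simp: mem_F\<close>)
qed (simp_all add: F_add_closed[simplified] add_ac, simp_all add: mem_F)

lemma F_zero_mem: "(\<lambda>x v. 0) \<in> carrier F"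
  by (simp add: mem_F)

text \<open>The full module axioms for \<open>F\<close> come later by transport, so closure under
  negatives is obtained here from the scalar matrix for -1.\<close>

lemma F_submoduleI:
  assumes sub: "H \<subseteq> carrier F" and 0: "(\<lambda>x v. 0) \<in> H"
    and add: "\<And>u w. u \<in> H \<Longrightarrow> w \<in> H \<Longrightarrow> (\<lambda>x v. u x v + w x v) \<in> H"
    and smult: "\<And>A u. A \<in> carrier (LT n) \<Longrightarrow> u \<in> H \<Longrightarrow> A \<odot>\<^bsub>F\<^esub> u \<in> H"
  shows "submodule H (LT n) F"
proof -
  interpret abelian_group F by (rule F_abelian_group)
  have neg: "\<ominus>\<^bsub>F\<^esub> u \<in> H" if u: "u \<in> H" for u
  proof -
    have uF: "u \<in> carrier F" using u sub by blast
    have eq: "((-1) \<cdot>\<^sub>m 1\<^sub>m n) \<odot>\<^bsub>F\<^esub> u = (\<lambda>x v. - u x v)"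
      using F_smult_scalar[OF uF, of "-1"] by simp
    then have mem: "(\<lambda>x v. - u x v) \<in> H" using smult[OF smult_one_LT u, of "-1"] by simp
    have "\<ominus>\<^bsub>F\<^esub> u = (\<lambda>x v. - u x v)"
      by (rule minus_equality) (use uF mem sub in \<open>auto simp: fun_eq_iff\<close>)
    then show ?thesis using mem by simp
  qed
  show ?thesis
    by (intro submodule.intro subgroup.intro submodule_axioms.intro)
      (use sub 0 add smult neg in \<open>auto simp: a_inv_def\<close>)
qed

text \<open>The vectors on the bar \<open>x\<close> form \<open>U\<close>; those that vanish on
  \<open>x\<close> form the complement \<open>V\<close>.\<close>

lemma interval_summand_if_bar:
  assumes x: "x \<in> X"
  shows "is_summand (LT n) (interval_module n (Suc (s x)) (Suc (t x))) F"
proof -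
  let ?N = "interval_module n (Suc (s x)) (Suc (t x)) :: ('a mat, 'a vec) module"
  define U where "U = {u \<in> carrier F. \<forall>y. y \<noteq> x \<longrightarrow> u y = (\<lambda>v. 0)}"
  define V where "V = {u \<in> carrier F. u x = (\<lambda>v. 0)}"
  have U: "submodule U (LT n) F"
    by (rule F_submoduleI)
      (auto simp: U_def F_smult_closed F_add_closed[simplified] F_smult F_zero_mem fun_eq_iff)
  have V: "submodule V (LT n) F"
    by (rule F_submoduleI)
      (auto simp: V_def F_smult_closed F_add_closed[simplified] F_smult F_zero_mem fun_eq_iff)
  have int: "U \<inter> V = {\<zero>\<^bsub>F\<^esub>}"
  proof -
    have "u = (\<lambda>x v. 0)" if "u \<in> U" "u \<in> V" for u
    proof
      fix y
      show "u y = (\<lambda>v. 0)" using that by (cases "y = x") (auto simp: U_def V_def)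
    qed
    moreover have "(\<lambda>x v. 0) \<in> U \<inter> V" by (auto simp: U_def V_def mem_F)
    ultimately show ?thesis by auto
  qed
  have sum: "U <+>\<^bsub>F\<^esub> V = carrier F"
  proof
    show "U <+>\<^bsub>F\<^esub> V \<subseteq> carrier F"
      by (auto simp: set_add_def' U_def V_def F_add_closed[simplified])
    show "carrier F \<subseteq> U <+>\<^bsub>F\<^esub> V"
    proof
      fix u assume u: "u \<in> carrier F"
      have "(\<lambda>y v. if y = x then u y v else 0) \<in> U" "(\<lambda>y v. if y = x then 0 else u y v) \<in> V"
        using u by (auto simp: U_def V_def mem_F)
      moreover have "u = (\<lambda>y v. if y = x then u y v else 0) \<oplus>\<^bsub>F\<^esub> (\<lambda>y v. if y = x then 0 else u y v)"
        by (auto simp: fun_eq_iff)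
      ultimately show "u \<in> U <+>\<^bsub>F\<^esub> V" unfolding set_add_def' by blast
    qed
  qed
  define h :: "'a vec \<Rightarrow> 'i \<Rightarrow> nat \<Rightarrow> 'a" where
    "h = (\<lambda>w\<in>carrier ?N. \<lambda>y v. if y = x \<and> s x \<le> v \<and> v \<le> t x then w $ v else 0)"
  have tn: "t x < n" using less[OF x] .
  have hU: "h w \<in> U" if "w \<in> carrier ?N" for w
    using that x by (auto simp: h_def U_def mem_F split: if_splits)
  have hom: "h \<in> lmod_hom (LT n) ?N (F\<lparr>carrier := U\<rparr>)"
    unfolding lmod_hom_def
  proof (intro CollectI conjI ballI)
    show "h \<in> carrier ?N \<rightarrow>\<^sub>E carrier (F\<lparr>carrier := U\<rparr>)"
      using hU by (auto simp: h_def)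
    fix w assume w: "w \<in> carrier ?N"
    {
      fix w' assume w': "w' \<in> carrier ?N"
      then show "h (w \<oplus>\<^bsub>?N\<^esub> w') = h w \<oplus>\<^bsub>F\<lparr>carrier := U\<rparr>\<^esub> h w'"
        using w interval_add_closed[OF w w'] tn by (auto simp: h_def fun_eq_iff mem_interval)
    }
    fix A :: "'a mat" assume A: "A \<in> carrier (LT n)"
    have "h (A \<odot>\<^bsub>?N\<^esub> w) y v = (A \<odot>\<^bsub>F\<^esub> h w) y v" for y v
    proof (cases "y = x \<and> s x \<le> v \<and> v \<le> t x")
      case True
      have "(\<Sum>r<n. A $$ (v, r) * w $ r) = (\<Sum>r<n. A $$ (v, r) * h w x r)"
        using w by (intro sum.cong) (auto simp: h_def mem_interval)
      moreover have "A \<in> carrier_mat n n" "w \<in> carrier_vec n"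
        using A w by (simp_all add: mem_LT mem_interval)
      ultimately show ?thesis
        using True x tn interval_smult_closed[OF w A] by (simp add: F_smult h_def interval_smult)
    next
      case False
      then show ?thesis using interval_smult_closed[OF w A] w by (cases "y = x") (auto simp: F_smult h_def)
    qed
    then show "h (A \<odot>\<^bsub>?N\<^esub> w) = A \<odot>\<^bsub>F\<lparr>carrier := U\<rparr>\<^esub> h w"
      by (simp add: fun_eq_iff)
  qed
  have "bij_betw h (carrier ?N) U"
  proof (rule bij_betwI')
    fix w w' assume w: "w \<in> carrier ?N" and w': "w' \<in> carrier ?N"
    show "h w = h w' \<longleftrightarrow> w = w'"
    proof
      assume eq: "h w = h w'"
      show "w = w'"
      proof (rule eq_vecI)
        fix v assume "v < dim_vec w'"
        then show "w $ v = w' $ v"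
          using w w' fun_cong[OF fun_cong[OF eq, of x], of v]
          by (cases "s x \<le> v \<and> v \<le> t x") (auto simp: h_def mem_interval)
      qed (use w w' in \<open>auto simp: mem_interval\<close>)
    qed simp
  next
    fix u assume u: "u \<in> U"
    let ?w = "vec n (u x)"
    have w: "?w \<in> carrier ?N" using u by (auto simp: mem_interval U_def mem_F)
    have "h ?w = u"
    proof (intro ext)
      fix y v
      show "h ?w y v = u y v"
        using u tn w F_eq_0[of u x v] by (cases "y = x") (auto simp: h_def U_def)
    qed
    then show "\<exists>w\<in>carrier ?N. u = h w" by (intro bexI[OF _ w]) simp
  qed (fact hU)
  then have "lmod_iso (LT n) ?N (F\<lparr>carrier := U\<rparr>)"
    unfolding lmod_iso_def using hom by auto
  then show ?thesis unfolding is_summand_def using U V int sum by blast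
qed

text \<open>This takes the place of the uniqueness part of the Krull-Schmidt theorem. What tells the
  interval \<open>[i, j]\<close> apart is that its vector at \<open>i\<close> survives to
  \<open>j\<close> and no further, while its vector at \<open>j\<close> is not a translate from a
  vertex before \<open>i\<close>.\<close>

lemma bar_if_interval_summand:
  assumes ij: "i \<le> j" "j < n"
    and sm: "is_summand (LT n) (interval_module n (Suc i) (Suc j)) F"
  shows "\<exists>x\<in>X. s x = i \<and> t x = j"
proof (rule ccontr)
  assume no: "\<not> ?thesis"
  let ?N = "interval_module n (Suc i) (Suc j) :: ('a mat, 'a vec) module"
  obtain U V where UV: "submodule U (LT n) F" "submodule V (LT n) F"
      "U \<inter> V = {\<zero>\<^bsub>F\<^esub>}" "U <+>\<^bsub>F\<^esub> V = carrier F" "lmod_iso (LT n) ?N (F\<lparr>carrier := U\<rparr>)"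
    using sm unfolding is_summand_def by blast
  then obtain h where h: "h \<in> lmod_hom (LT n) ?N (F\<lparr>carrier := U\<rparr>)" "bij_betw h (carrier ?N) U"
    unfolding lmod_iso_def by auto
  have U: "U \<subseteq> carrier F" and Uadd: "\<And>u w. u \<in> U \<Longrightarrow> w \<in> U \<Longrightarrow> u \<oplus>\<^bsub>F\<^esub> w \<in> U"
    and Usm: "\<And>A u. A \<in> carrier (LT n) \<Longrightarrow> u \<in> U \<Longrightarrow> A \<odot>\<^bsub>F\<^esub> u \<in> U"
    using UV(1) by (auto simp: submodule_def subgroup_def submodule_axioms_def)
  have V: "V \<subseteq> carrier F" and Vsm: "\<And>A u. A \<in> carrier (LT n) \<Longrightarrow> u \<in> V \<Longrightarrow> A \<odot>\<^bsub>F\<^esub> u \<in> V"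
    using UV(2) by (auto simp: submodule_def subgroup_def submodule_axioms_def)
  have hU: "h w \<in> U" if "w \<in> carrier ?N" for w
    using h(2) that by (auto simp: bij_betw_def)
  have hsm: "h (A \<odot>\<^bsub>?N\<^esub> w) = A \<odot>\<^bsub>F\<^esub> h w" if "w \<in> carrier ?N" "A \<in> carrier (LT n)" for A w
    using h(1) that by (auto simp: lmod_hom_def)
  let ?e = "unit_vec n :: nat \<Rightarrow> 'a vec"
  have e: "?e p \<in> carrier ?N" if "i \<le> p" "p \<le> j" for p
    using that by (auto simp: mem_interval unit_vec_def)
  have 0: "0\<^sub>v n \<in> carrier ?N" by (simp add: mem_interval)
  have h0: "h (0\<^sub>v n) = (\<lambda>x v. 0)"
  proof -
    have "(0 \<cdot>\<^sub>m 1\<^sub>m n) \<odot>\<^bsub>?N\<^esub> 0\<^sub>v n = 0\<^sub>v n" by (auto simp: interval_smult intro!: eq_vecI sum.neutral)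
    then have "h (0\<^sub>v n) = (0 \<cdot>\<^sub>m 1\<^sub>m n) \<odot>\<^bsub>F\<^esub> h (0\<^sub>v n)" using hsm[OF 0 smult_one_LT, of 0] by simp
    moreover have "h (0\<^sub>v n) \<in> carrier F" using hU[OF 0] U by blast
    ultimately show ?thesis by (simp add: F_smult_scalar)
  qed
  define w where "w = h (?e i)"
  have wU: "w \<in> U" using hU e ij by (simp add: w_def)
  then have wF: "w \<in> carrier F" using U by blast
  have i: "i < n" using ij by simp
  have ei: "?e i \<in> carrier_vec n" by simp
  have ji: "munit n j i \<odot>\<^bsub>F\<^esub> w = h (?e j)"
  proof -
    have "munit n j i \<odot>\<^bsub>?N\<^esub> ?e i = ?e j"
      unfolding interval_smult_munit[OF ei i] using ij by (auto simp: unit_vec_def intro!: eq_vecI)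
    then show ?thesis using hsm[OF e[OF order_refl ij(1)] munit_LT[OF ij(1)]] ij by (simp add: w_def)
  qed
  \<comment> \<open>In the interval module the path to \<open>Suc j\<close> kills the generator, so
    it kills \<open>w\<close>. A bar that carries \<open>w\<close> at \<open>i\<close> therefore
    cannot reach \<open>Suc j\<close>.\<close>
  have tj: "t y \<le> j" if "w y i \<noteq> 0" for y
  proof (rule ccontr)
    assume "\<not> t y \<le> j"
    then have j: "Suc j \<le> t y" by simp
    have y: "y \<in> X" "s y \<le> i" using that wF by (auto simp: mem_F)
    have "munit n (Suc j) i \<odot>\<^bsub>?N\<^esub> ?e i = 0\<^sub>v n"
      unfolding interval_smult_munit[OF ei i] by (auto intro!: eq_vecI)
    then have "munit n (Suc j) i \<odot>\<^bsub>F\<^esub> w = (\<lambda>x v. 0)"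
      using hsm[OF e[OF order_refl ij(1)] munit_LT[of i "Suc j"]] ij by (simp add: w_def h0)
    from fun_cong[OF fun_cong[OF this, of y], of "Suc j"] show False
      using that j y ij i by (simp add: F_smult_munit)
  qed
  have sy: "s y < i" if "w y i \<noteq> 0" "j \<le> t y" for y
  proof -
    have "y \<in> X" "s y \<le> i" using that wF by (auto simp: mem_F)
    moreover have "t y = j" using tj that by force
    ultimately show ?thesis using no by force
  qed
  \<comment> \<open>Without the bar \<open>[i, j]\<close>, every bar on which \<open>w\<close> survives up to \<open>j\<close> starts before \<open>i\<close>. So \<open>h (e\<^sub>j)\<close>
    comes from vertex \<open>i - 1\<close>, hence so does its component in \<open>U\<close>, where vertex \<open>i - 1\<close> is zero.\<close>
  define w' where "w' = (\<lambda>y v. if Suc v = i \<and> j \<le> t y then w y i else 0)"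
  have "w' \<in> carrier F"
    using sy wF ij by (fastforce simp: w'_def mem_F split: if_splits)
  then obtain a b where ab: "a \<in> U" "b \<in> V" "w' = a \<oplus>\<^bsub>F\<^esub> b"
    using UV(4) unfolding set_add_def' by blast
  define q where "q = i - 1"
  have q: "q \<le> j" "q < n" using ij by (auto simp: q_def)
  \<comment> \<open>For \<open>i = 0\<close> no bar starts before \<open>i\<close>, so nothing of
    \<open>w\<close> would reach \<open>j\<close>, and \<open>h\<close> would kill the vector at
    \<open>j\<close>.\<close>
  have "i > 0"
  proof (rule ccontr)
    assume "\<not> i > 0"
    then have "(munit n j i \<odot>\<^bsub>F\<^esub> w) y v = 0" for y v
      unfolding F_smult_munit[OF i] using sy[of y] by auto
    then have "munit n j i \<odot>\<^bsub>F\<^esub> w = (\<lambda>x v. 0)" by (intro ext)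
    then have "h (?e j) = h (0\<^sub>v n)" using ji h0 by simp
    then have "?e j = 0\<^sub>v n" using h(2) e[of j] 0 ij by (auto simp: bij_betw_def inj_on_def)
    then have "?e j $ j = 0\<^sub>v n $ j" by simp
    then show False using ij by simp
  qed
  have jq: "munit n j q \<odot>\<^bsub>F\<^esub> w' = munit n j i \<odot>\<^bsub>F\<^esub> w"
  proof (intro ext)
    fix y v
    show "(munit n j q \<odot>\<^bsub>F\<^esub> w') y v = (munit n j i \<odot>\<^bsub>F\<^esub> w) y v"
      unfolding F_smult_munit[OF i] F_smult_munit[OF q(2)] using \<open>i > 0\<close>
      by (auto simp: w'_def q_def)
  qed
  define a' where "a' = munit n j q \<odot>\<^bsub>F\<^esub> a"
  define b' where "b' = munit n j q \<odot>\<^bsub>F\<^esub> b"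
  have ab': "a' \<in> U" "b' \<in> V" using ab q Usm Vsm munit_LT unfolding a'_def b'_def by blast+
  have hj: "h (?e j) = (\<lambda>x v. a' x v + b' x v)"
    using jq ji F_smult_r_distr[of "munit n j q" a b] ab(3) by (simp add: a'_def b'_def)
  \<comment> \<open>The part \<open>b'\<close> in the complement is a difference of two elements of
    \<open>U\<close>, so it lies in \<open>U \<inter> V\<close> and vanishes.\<close>
  have "(\<lambda>x v. - a' x v) \<in> U"
    using Usm[OF smult_one_LT ab'(1), of "-1"] F_smult_scalar[of a' "-1"] U ab'(1) by auto
  then have "h (?e j) \<oplus>\<^bsub>F\<^esub> (\<lambda>x v. - a' x v) \<in> U"
    using Uadd hU[OF e[of j]] ij by blast
  moreover have "h (?e j) \<oplus>\<^bsub>F\<^esub> (\<lambda>x v. - a' x v) = b'" by (simp add: hj fun_eq_iff)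
  ultimately have "b' \<in> U \<inter> V" using ab' by simp
  then have "b' = (\<lambda>x v. 0)" using UV(3) by simp
  then have hja: "h (?e j) = a'" by (simp add: hj)
  obtain \<alpha> where \<alpha>: "\<alpha> \<in> carrier ?N" "a = h \<alpha>" using ab(1) h(2) by (auto simp: bij_betw_def)
  \<comment> \<open>Vertex \<open>q\<close> is outside the interval, so the part of
    \<open>w'\<close> in \<open>U\<close> is zero there and has nothing to move to
    \<open>j\<close>.\<close>
  have "\<alpha> $ q = 0" using \<alpha>(1) q \<open>i > 0\<close> by (auto simp: mem_interval q_def)
  moreover have "\<alpha> \<in> carrier_vec n" using \<alpha>(1) by (simp add: mem_interval)
  ultimately have "munit n j q \<odot>\<^bsub>?N\<^esub> \<alpha> = 0\<^sub>v n"
    using interval_smult_munit[OF _ q(2), where q = j and i = i and j = j and v = \<alpha>] by (auto intro!: eq_vecI)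
  then have "h (?e j) = h (0\<^sub>v n)"
    using hsm[OF \<alpha>(1) munit_LT[OF q(1)]] \<alpha>(2) hja by (simp add: a'_def)
  then have "?e j = 0\<^sub>v n" using h(2) e[of j] 0 ij by (auto simp: bij_betw_def inj_on_def)
  then have "?e j $ j = 0\<^sub>v n $ j" by simp
  then show False using ij by simp
qed

end

section \<open>Decomposition into interval modules\<close>

context left_module
begin

lemma smult_r_null:
  assumes "a \<in> carrier R"
  shows "a \<odot>\<^bsub>M\<^esub> \<zero>\<^bsub>M\<^esub> = \<zero>\<^bsub>M\<^esub>"
proof -
  have z: "a \<odot>\<^bsub>M\<^esub> \<zero>\<^bsub>M\<^esub> \<in> carrier M" using assms by (simp add: smult_closed)
  have "a \<odot>\<^bsub>M\<^esub> \<zero>\<^bsub>M\<^esub> \<oplus>\<^bsub>M\<^esub> a \<odot>\<^bsub>M\<^esub> \<zero>\<^bsub>M\<^esub> = a \<odot>\<^bsub>M\<^esub> \<zero>\<^bsub>M\<^esub>"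
    using smult_r_distr[OF assms M.zero_closed M.zero_closed] by simp
  then show ?thesis using z M.add.r_cancel_one by simp
qed

lemma smult_l_null:
  assumes "x \<in> carrier M"
  shows "\<zero>\<^bsub>R\<^esub> \<odot>\<^bsub>M\<^esub> x = \<zero>\<^bsub>M\<^esub>"
proof -
  have z: "\<zero>\<^bsub>R\<^esub> \<odot>\<^bsub>M\<^esub> x \<in> carrier M" using assms by (simp add: smult_closed)
  have "\<zero>\<^bsub>R\<^esub> \<odot>\<^bsub>M\<^esub> x \<oplus>\<^bsub>M\<^esub> \<zero>\<^bsub>R\<^esub> \<odot>\<^bsub>M\<^esub> x = \<zero>\<^bsub>R\<^esub> \<odot>\<^bsub>M\<^esub> x"
    using smult_l_distr[OF R.zero_closed R.zero_closed assms] by simp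
  then show ?thesis using z M.add.r_cancel_one by simp
qed

lemma smult_minus_one:
  assumes "x \<in> carrier M"
  shows "(\<ominus>\<^bsub>R\<^esub> \<one>\<^bsub>R\<^esub>) \<odot>\<^bsub>M\<^esub> x = \<ominus>\<^bsub>M\<^esub> x"
proof (rule M.minus_equality[symmetric])
  show "(\<ominus>\<^bsub>R\<^esub> \<one>\<^bsub>R\<^esub>) \<odot>\<^bsub>M\<^esub> x \<oplus>\<^bsub>M\<^esub> x = \<zero>\<^bsub>M\<^esub>"
    using smult_l_distr[of "\<ominus>\<^bsub>R\<^esub> \<one>\<^bsub>R\<^esub>" "\<one>\<^bsub>R\<^esub>" x] assms
    by (simp add: smult_one R.l_neg smult_l_null)
qed (use assms in \<open>simp_all add: smult_closed\<close>)

lemma smult_finsum: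
  assumes "finite A" "a \<in> carrier R" "f \<in> A \<rightarrow> carrier M"
  shows "a \<odot>\<^bsub>M\<^esub> (\<Oplus>\<^bsub>M\<^esub>x\<in>A. f x) = (\<Oplus>\<^bsub>M\<^esub>x\<in>A. a \<odot>\<^bsub>M\<^esub> f x)"
  using assms
proof (induction A rule: finite_induct)
  case (insert x A)
  then show ?case by (simp add: Pi_def smult_closed smult_r_distr)
qed (simp add: smult_r_null)

lemma submoduleI:
  assumes sub: "H \<subseteq> carrier M" and 0: "\<zero>\<^bsub>M\<^esub> \<in> H"
    and add: "\<And>x y. x \<in> H \<Longrightarrow> y \<in> H \<Longrightarrow> x \<oplus>\<^bsub>M\<^esub> y \<in> H"
    and smult: "\<And>a x. a \<in> carrier R \<Longrightarrow> x \<in> H \<Longrightarrow> a \<odot>\<^bsub>M\<^esub> x \<in> H"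
  shows "submodule H R M"
proof -
  have "\<ominus>\<^bsub>M\<^esub> x \<in> H" if "x \<in> H" for x
    using smult[of "\<ominus>\<^bsub>R\<^esub> \<one>\<^bsub>R\<^esub>" x] smult_minus_one[of x] that sub by auto
  then show ?thesis
    by (intro submodule.intro subgroup.intro submodule_axioms.intro)
      (use sub 0 add smult in \<open>auto simp: a_inv_def\<close>)
qed

lemma submodule_closed:
  assumes "submodule H R M"
  shows "H \<subseteq> carrier M" "\<zero>\<^bsub>M\<^esub> \<in> H" "\<And>x y. x \<in> H \<Longrightarrow> y \<in> H \<Longrightarrow> x \<oplus>\<^bsub>M\<^esub> y \<in> H"
    "\<And>a x. a \<in> carrier R \<Longrightarrow> x \<in> H \<Longrightarrow> a \<odot>\<^bsub>M\<^esub> x \<in> H" "\<And>x. x \<in> H \<Longrightarrow> \<ominus>\<^bsub>M\<^esub> x \<in> H"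
  using assms by (auto simp: submodule_def subgroup_def submodule_axioms_def a_inv_def)

lemma submodule_finsum:
  assumes H: "submodule H R M" and "finite A" "\<And>x. x \<in> A \<Longrightarrow> f x \<in> H"
  shows "(\<Oplus>\<^bsub>M\<^esub>x\<in>A. f x) \<in> H"
  using assms(2,3)
proof (induction A rule: finite_induct)
  case (insert x A)
  moreover have "f \<in> A \<rightarrow> carrier M" "f x \<in> carrier M"
    using insert submodule_closed(1)[OF H] by auto
  ultimately show ?case using submodule_closed(3)[OF H] by simp
qed (simp add: submodule_closed(2)[OF H])

end

text \<open>A combination of the paths that start at \<open>p\<close>; it turns a generator at
  vertex \<open>p\<close> into a combination of its translates. Values of \<open>f\<close> before
  \<open>p\<close> are cut off, so that the coordinate function of a bar can be inserted as it
  is.\<close>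

definition col_mat :: "nat \<Rightarrow> nat \<Rightarrow> (nat \<Rightarrow> 'a) \<Rightarrow> 'a::field mat" where
  "col_mat n p f = mat n n (\<lambda>(r, c). if c = p \<and> p \<le> r then f r else 0)"

lemma col_mat_LT: "col_mat n p f \<in> carrier (LT n)"
  by (auto simp: col_mat_def mem_LT)

lemma munit_eq_col_mat: "p \<le> q \<Longrightarrow> munit n q p = col_mat n p (\<lambda>r. if r = q then 1 else 0)"
  by (auto simp: munit_def col_mat_def intro!: eq_matI)

lemma col_mat_add: "col_mat n p (\<lambda>r. f r + h r) = col_mat n p f + col_mat n p h"
  by (auto simp: col_mat_def intro!: eq_matI)

lemma col_mat_zero: "(\<And>r. p \<le> r \<Longrightarrow> r < n \<Longrightarrow> f r = 0) \<Longrightarrow> col_mat n p f = 0\<^sub>m n n"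
  by (auto simp: col_mat_def intro!: eq_matI)

text \<open>The rows before \<open>p\<close> stay zero, since a nonzero product needs
  \<open>p \<le> q\<close> and \<open>q \<le> r\<close>.\<close>

lemma mat_times_col_mat:
  assumes A: "A \<in> carrier (LT n)"
  shows "A * col_mat n p f = col_mat n p (\<lambda>r. \<Sum>q<n. A $$ (r, q) * (if p \<le> q then f q else 0))"
proof (rule eq_matI)
  let ?c = "col_mat n p (\<lambda>r. \<Sum>q<n. A $$ (r, q) * (if p \<le> q then f q else 0))"
  fix r c assume "r < dim_row ?c" "c < dim_col ?c"
  then have rc: "r < n" "c < n" by (auto simp: col_mat_def)
  have A': "A \<in> carrier_mat n n" using A by (simp add: mem_LT)
  have "(A * col_mat n p f) $$ (r, c) = (\<Sum>q<n. A $$ (r, q) * col_mat n p f $$ (q, c))"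
    using rc A' by (simp add: scalar_prod_def lessThan_atLeast0 col_mat_def)
  also have "\<dots> = (if c = p \<and> p \<le> r then \<Sum>q<n. A $$ (r, q) * (if p \<le> q then f q else 0) else 0)"
  proof -
    have "A $$ (r, q) * col_mat n p f $$ (q, c) =
        (if c = p \<and> p \<le> r then A $$ (r, q) * (if p \<le> q then f q else 0) else 0)" if "q < n" for q
      using that rc A by (auto simp: col_mat_def mem_LT)
    then have "(\<Sum>q<n. A $$ (r, q) * col_mat n p f $$ (q, c)) =
        (\<Sum>q<n. if c = p \<and> p \<le> r then A $$ (r, q) * (if p \<le> q then f q else 0) else 0)"
      by (intro sum.cong) auto
    then show ?thesis
      by (cases "c = p \<and> p \<le> r") (simp_all only: if_True if_False sum.neutral_const simp_thms)
  qed
  finally show "(A * col_mat n p f) $$ (r, c) = ?c $$ (r, c)" using rc by (simp add: col_mat_def)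
qed (use A in \<open>auto simp: mem_LT col_mat_def\<close>)

text \<open>For \<open>v < p\<close> the left side is zero, and with \<open>w = v\<close> so is the
  right side, because row \<open>w\<close> is then cut off. This case lets an idempotent act on
  translates of generators that start later.\<close>

lemma munit_times_col_mat:
  assumes "v \<le> w" "p \<le> v \<or> v = w" "v < n"
  shows "munit n w v * col_mat n p f = col_mat n p (\<lambda>r. if r = w then f v else 0)"
proof -
  have "(\<Sum>q<n. munit n w v $$ (r, q) * (if p \<le> q then f q else 0)) =
      (if r = w \<and> p \<le> v then f v else 0)" if "r < n" for r
  proof -
    have "(\<Sum>q<n. munit n w v $$ (r, q) * (if p \<le> q then f q else 0)) =
        (\<Sum>q<n. if q = v then (if r = w \<and> p \<le> v then f v else 0) else 0)"
      using that by (intro sum.cong) (auto simp: munit_def)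
    then show ?thesis using assms by (simp add: sum.delta)
  qed
  then have "col_mat n p (\<lambda>r. \<Sum>q<n. munit n w v $$ (r, q) * (if p \<le> q then f q else 0)) =
      col_mat n p (\<lambda>r. if r = w then f v else 0)"
    using assms(2) by (auto simp: col_mat_def intro!: eq_matI)
  then show ?thesis by (rule trans[OF mat_times_col_mat[OF munit_LT[OF assms(1)]]])
qed

lemma munit_times_munit:
  "p \<le> v \<Longrightarrow> v \<le> w \<Longrightarrow> v < n \<Longrightarrow> munit n w v * munit n v p = (munit n w p :: 'a::field mat)"
  by (simp add: munit_eq_col_mat[of p] munit_times_col_mat)

text \<open>All paths involved pass through \<open>k\<close>. With \<open>k\<close> just after the
  end of a bar, a combination of such paths kills the generator of the bar.\<close>

lemma col_mat_times_munit:
  assumes "p \<le> k" "k < n" and f: "\<And>r. r < k \<Longrightarrow> f r = 0"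
  shows "col_mat n k f * munit n k p = col_mat n p f"
proof -
  have "(\<Sum>q<n. col_mat n k f $$ (r, q) * (if p \<le> q then if q = k then 1 else 0 else 0)) =
      (if k \<le> r then f r else 0)" if "r < n" for r
  proof -
    have "(\<Sum>q<n. col_mat n k f $$ (r, q) * (if p \<le> q then if q = k then 1 else 0 else 0)) =
        (\<Sum>q<n. if q = k then (if k \<le> r then f r else 0) else 0)"
      using that assms(1) by (intro sum.cong) (auto simp: col_mat_def)
    then show ?thesis using assms by (simp add: sum.delta)
  qed
  then have "col_mat n p (\<lambda>r. \<Sum>q<n. col_mat n k f $$ (r, q) * (if p \<le> q then if q = k then 1 else 0 else 0)) =
      col_mat n p f"
    using f by (auto simp: col_mat_def intro!: eq_matI)
  then show ?thesis
    unfolding munit_eq_col_mat[OF assms(1)] by (rule trans[OF mat_times_col_mat[OF col_mat_LT]])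
qed

section \<open>Minimal families of homogeneous generators\<close>

locale lower_triangular_module = left_module "LT n" M
  for n :: nat and M :: "('a::field mat, 'b, 'c) module_scheme"
begin

lemma smult_smult:
  "A \<in> carrier (LT n) \<Longrightarrow> B \<in> carrier (LT n) \<Longrightarrow> x \<in> carrier M \<Longrightarrow>
    A \<odot>\<^bsub>M\<^esub> (B \<odot>\<^bsub>M\<^esub> x) = (A * B) \<odot>\<^bsub>M\<^esub> x"
  using smult_assoc by simp

definition homogeneous :: "'i set \<Rightarrow> ('i \<Rightarrow> nat) \<Rightarrow> ('i \<Rightarrow> 'b) \<Rightarrow> bool" where
  "homogeneous X s g \<longleftrightarrow> (\<forall>x\<in>X. g x \<in> carrier M \<and> munit n (s x) (s x) \<odot>\<^bsub>M\<^esub> g x = g x)"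

definition generating :: "'i set \<Rightarrow> ('i \<Rightarrow> 'b) \<Rightarrow> bool" where
  "generating X g \<longleftrightarrow> (\<forall>N. submodule N (LT n) M \<and> g ` X \<subseteq> N \<longrightarrow> N = carrier M)"

text \<open>For a minimal family this becomes the bar of \<open>x\<close>; the total size of these
  sets is the quantity to be minimised.\<close>

definition orbit :: "('i \<Rightarrow> nat) \<Rightarrow> ('i \<Rightarrow> 'b) \<Rightarrow> 'i \<Rightarrow> nat set" where
  "orbit s g x = {v. s x \<le> v \<and> v < n \<and> munit n v (s x) \<odot>\<^bsub>M\<^esub> g x \<noteq> \<zero>\<^bsub>M\<^esub>}"

lemma munit_smult_munit:
  assumes "x \<in> carrier M" "p \<le> v" "v \<le> w" "v < n"
  shows "munit n w v \<odot>\<^bsub>M\<^esub> (munit n v p \<odot>\<^bsub>M\<^esub> x) = munit n w p \<odot>\<^bsub>M\<^esub> x"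
  using assms by (simp add: smult_smult munit_LT munit_times_munit)

text \<open>The path to \<open>w\<close> factors through \<open>v\<close>, so a translate that is
  zero at \<open>v\<close> stays zero.\<close>

lemma orbit_down:
  assumes "g x \<in> carrier M" "w \<in> orbit s g x" "s x \<le> v" "v \<le> w"
  shows "v \<in> orbit s g x"
proof -
  have "munit n w v \<odot>\<^bsub>M\<^esub> (munit n v (s x) \<odot>\<^bsub>M\<^esub> g x) \<noteq> \<zero>\<^bsub>M\<^esub>"
    using assms munit_smult_munit[of "g x" "s x" v w] by (simp add: orbit_def)
  then have "munit n v (s x) \<odot>\<^bsub>M\<^esub> g x \<noteq> \<zero>\<^bsub>M\<^esub>"
    using smult_r_null[OF munit_LT[OF assms(4)]] by auto
  then show ?thesis using assms by (simp add: orbit_def)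
qed

text \<open>The replacement keeps the index set and all starts. The coefficient of
  \<open>g x0\<close> in the new generator is invertible and the other generators are kept, so the
  new family still generates. By the relation the new generator dies at \<open>v\<close>, where the
  old one was alive.\<close>

lemma exchange:
  fixes X :: "'i set"
  assumes X: "finite X" and sn: "\<And>x. x \<in> X \<Longrightarrow> s x < n"
    and hg: "homogeneous X s g" and gen: "generating X g"
    and Y: "Y \<subseteq> X" "Y \<noteq> {}"
    and vY: "\<And>x. x \<in> Y \<Longrightarrow> v \<in> orbit s g x" and c: "\<And>x. x \<in> Y \<Longrightarrow> c x \<noteq> 0"
    and rel: "(\<Oplus>\<^bsub>M\<^esub>x\<in>Y. col_mat n (s x) (\<lambda>r. if r = v then c x else 0) \<odot>\<^bsub>M\<^esub> g x) = \<zero>\<^bsub>M\<^esub>"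
  shows "\<exists>g'. homogeneous X s g' \<and> generating X g' \<and>
    (\<Sum>x\<in>X. card (orbit s g' x)) < (\<Sum>x\<in>X. card (orbit s g x))"
proof -
  have fY: "finite Y" using X Y finite_subset by blast
  \<comment> \<open>The latest start is chosen so that every other generator in the relation can be
    moved forward to it.\<close>
  have "Max (s ` Y) \<in> s ` Y" using fY Y by (intro Max_in) auto
  then obtain x0 where x0': "x0 \<in> Y" "s x0 = Max (s ` Y)" by auto
  then have x0: "x0 \<in> Y" "\<And>x. x \<in> Y \<Longrightarrow> s x \<le> s x0" using fY by auto
  define p where "p = s x0"
  have x0X: "x0 \<in> X" using x0 Y by blast
  have gM: "g x \<in> carrier M" if "x \<in> X" for x using hg that by (simp add: homogeneous_def)
  have gY: "g x \<in> carrier M" if "x \<in> Y" for x using gM that Y by blast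
  have pn: "p < n" using sn[OF x0X] by (simp add: p_def)
  have pv: "p \<le> v" "v < n" using vY[OF x0(1)] by (auto simp: p_def orbit_def)
  \<comment> \<open>\<open>e w x\<close> is \<open>c x\<close> times the translate of
    \<open>g x\<close> at \<open>w\<close>; for \<open>w = v\<close> these are the terms of the
    relation.\<close>
  define e where "e w x = col_mat n (s x) (\<lambda>r. if r = w then c x else 0) \<odot>\<^bsub>M\<^esub> g x" for w x
  have eM: "e w \<in> Y \<rightarrow> carrier M" for w
    using gY by (auto simp: e_def intro!: smult_closed col_mat_LT)
  define g0 where "g0 = (\<Oplus>\<^bsub>M\<^esub>x\<in>Y. e p x)"
  have g0M: "g0 \<in> carrier M" unfolding g0_def by (rule M.finsum_closed[OF eM])
  have ew: "munit n w p \<odot>\<^bsub>M\<^esub> e p x = e w x" if "x \<in> Y" "p \<le> w" for w x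
    using that x0(2) pn
    by (simp add: e_def smult_smult munit_LT col_mat_LT gY munit_times_col_mat p_def)
  have g0w: "munit n w p \<odot>\<^bsub>M\<^esub> g0 = (\<Oplus>\<^bsub>M\<^esub>x\<in>Y. e w x)" if "p \<le> w" for w
  proof -
    have "munit n w p \<odot>\<^bsub>M\<^esub> g0 = (\<Oplus>\<^bsub>M\<^esub>x\<in>Y. munit n w p \<odot>\<^bsub>M\<^esub> e p x)"
      unfolding g0_def by (rule smult_finsum[OF fY munit_LT[OF that] eM])
    also have "\<dots> = (\<Oplus>\<^bsub>M\<^esub>x\<in>Y. e w x)"
      using ew that eM by (intro M.finsum_cong') auto
    finally show ?thesis .
  qed
  have g0v: "munit n v p \<odot>\<^bsub>M\<^esub> g0 = \<zero>\<^bsub>M\<^esub>"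
    using g0w[OF pv(1)] rel by (simp add: e_def)
  define g' where "g' = g(x0 := g0)"
  have "homogeneous X s g'"
    using hg g0M g0w[of p] by (simp add: homogeneous_def g'_def p_def[symmetric] g0_def)
  moreover have "generating X g'"
    unfolding generating_def
  proof (intro allI impI)
    fix N assume N: "submodule N (LT n) M \<and> g' ` X \<subseteq> N"
    note sub = submodule_closed[OF conjunct1[OF N]]
    have g'N: "g' x \<in> N" if "x \<in> X" for x using N that by blast
    have rest: "(\<Oplus>\<^bsub>M\<^esub>x\<in>Y - {x0}. e p x) \<in> N"
    proof (rule submodule_finsum)
      fix x assume x: "x \<in> Y - {x0}"
      then have "g x \<in> N" using g'N[of x] Y by (auto simp: g'_def)
      then show "e p x \<in> N" unfolding e_def by (intro sub(4) col_mat_LT)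
    qed (use N fY in auto)
    \<comment> \<open>Solving for the term of \<open>x0\<close> recovers \<open>g x0\<close>, since
      the other terms come from generators that were kept.\<close>
    have "g0 = e p x0 \<oplus>\<^bsub>M\<^esub> (\<Oplus>\<^bsub>M\<^esub>x\<in>Y - {x0}. e p x)"
    proof -
      have "insert x0 (Y - {x0}) = Y" using x0 by blast
      then have "g0 = (\<Oplus>\<^bsub>M\<^esub>x\<in>insert x0 (Y - {x0}). e p x)" by (simp add: g0_def)
      also have "\<dots> = e p x0 \<oplus>\<^bsub>M\<^esub> (\<Oplus>\<^bsub>M\<^esub>x\<in>Y - {x0}. e p x)"
        using fY eM[of p] x0(1) by (intro M.finsum_insert) auto
      finally show ?thesis .
    qed
    moreover have mem: "e p x0 \<in> carrier M" "(\<Oplus>\<^bsub>M\<^esub>x\<in>Y - {x0}. e p x) \<in> carrier M"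
      using eM[of p] x0(1) rest sub(1) by auto
    ultimately have "e p x0 = g0 \<oplus>\<^bsub>M\<^esub> \<ominus>\<^bsub>M\<^esub> (\<Oplus>\<^bsub>M\<^esub>x\<in>Y - {x0}. e p x)"
      by (simp add: M.a_assoc M.r_neg)
    moreover have "g0 \<in> N" using g'N[OF x0X] by (simp add: g'_def)
    ultimately have "e p x0 \<in> N" using sub(3)[OF _ sub(5)[OF rest]] by simp
    moreover have "g x0 = (inverse (c x0) \<cdot>\<^sub>m 1\<^sub>m n) \<odot>\<^bsub>M\<^esub> e p x0"
    proof -
      have "(inverse (c x0) \<cdot>\<^sub>m 1\<^sub>m n) * col_mat n p (\<lambda>r. if r = p then c x0 else 0) = munit n p p"
        using c[OF x0(1)] by (auto simp: col_mat_def munit_def intro!: eq_matI)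
      then show ?thesis
        using hg x0X gM[OF x0X]
        by (simp add: e_def smult_smult smult_one_LT col_mat_LT p_def[symmetric] homogeneous_def)
          (simp add: p_def)
    qed
    ultimately have "g x0 \<in> N" using sub(4)[OF smult_one_LT] by simp
    then have "g x \<in> N" if "x \<in> X" for x
      using g'N[OF that] by (cases "x = x0") (simp_all add: g'_def)
    then have "g ` X \<subseteq> N" by blast
    then show "N = carrier M" using gen N by (simp add: generating_def)
  qed
  moreover have "(\<Sum>x\<in>X. card (orbit s g' x)) < (\<Sum>x\<in>X. card (orbit s g x))"
  proof (rule sum_strict_mono_ex1[OF X])
    have fin: "finite (orbit s h x)" for h :: "'i \<Rightarrow> 'b" and x by (rule finite_subset[of _ "{..<n}"]) (auto simp: orbit_def)
    \<comment> \<open>The new orbit is an initial segment from \<open>p\<close> that misses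
      \<open>v\<close>, while the old one contains everything from \<open>p\<close> to
      \<open>v\<close>.\<close>
    have "orbit s g' x0 \<subset> orbit s g x0"
    proof
      have "v \<notin> orbit s g' x0" using g0v by (simp add: orbit_def g'_def p_def)
      then show "orbit s g' x0 \<noteq> orbit s g x0" using vY[OF x0(1)] by metis
      show "orbit s g' x0 \<subseteq> orbit s g x0"
      proof
        fix w assume w: "w \<in> orbit s g' x0"
        have "w < v"
        proof (rule ccontr)
          assume "\<not> w < v"
          then have "v \<in> orbit s g' x0"
            using orbit_down[of g' x0 w s v] w pv g0M by (simp add: g'_def p_def)
          then show False using \<open>v \<notin> orbit s g' x0\<close> by simp
        qed
        then show "w \<in> orbit s g x0"
          using orbit_down[of g x0 v s w] gM[OF x0X] vY[OF x0(1)] w by (simp add: orbit_def)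
      qed
    qed
    then have lt: "card (orbit s g' x0) < card (orbit s g x0)" by (intro psubset_card_mono fin)
    show "\<exists>a\<in>X. card (orbit s g' a) < card (orbit s g a)" using lt x0X by blast
    have "orbit s g' x = orbit s g x" if "x \<noteq> x0" for x using that by (simp add: orbit_def g'_def)
    then show "\<forall>x\<in>X. card (orbit s g' x) \<le> card (orbit s g x)"
      using lt less_imp_le by (metis order_refl)
  qed
  ultimately show ?thesis by blast
qed


text \<open>The idempotents of the vertices sum to 1, so each given generator is the sum of its
  parts at the single vertices.\<close>

lemma homogeneous_generating_exists:
  assumes "finitely_generated (LT n) M"
  shows "\<exists>(S :: 'b set) g. finite S \<and> homogeneous (S \<times> {..<n}) snd g \<and> generating (S \<times> {..<n}) g"
proof -
  obtain S where S: "finite S" "S \<subseteq> carrier M"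
      "\<And>N. submodule N (LT n) M \<Longrightarrow> S \<subseteq> N \<Longrightarrow> N = carrier M"
    using assms unfolding finitely_generated_def by blast
  define g where "g = (\<lambda>(x, p). munit n p p \<odot>\<^bsub>M\<^esub> x)"
  have "homogeneous (S \<times> {..<n}) snd g"
    using S(2) by (auto simp: homogeneous_def g_def munit_smult_munit smult_closed munit_LT)
  moreover have "generating (S \<times> {..<n}) g"
    unfolding generating_def
  proof (intro allI impI)
    fix N assume N: "submodule N (LT n) M \<and> g ` (S \<times> {..<n}) \<subseteq> N"
    note sub = submodule_closed[OF conjunct1[OF N]]
    have "x \<in> N" if x: "x \<in> S" for x
    proof -
      \<comment> \<open>These are the partial sums of the idempotents, from 0 up to the identity
        matrix \<open>D n\<close>.\<close>
      define D :: "nat \<Rightarrow> 'a mat" where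
        "D k = mat n n (\<lambda>(r, c). if r = c \<and> r < k then 1 else 0)" for k
      have D: "D k \<in> carrier (LT n)" for k by (auto simp: D_def mem_LT)
      have xM: "x \<in> carrier M" using x S(2) by blast
      have Dk: "k \<le> n \<Longrightarrow> D k \<odot>\<^bsub>M\<^esub> x \<in> N" for k
      proof (induction k)
        case 0
        have "D 0 = 0\<^sub>m n n" by (auto simp: D_def intro!: eq_matI)
        then show ?case using smult_l_null[OF xM] sub(2) by simp
      next
        case (Suc k)
        have "D (Suc k) = D k + munit n k k" by (auto simp: D_def munit_def intro!: eq_matI)
        then have "D (Suc k) \<odot>\<^bsub>M\<^esub> x = D k \<odot>\<^bsub>M\<^esub> x \<oplus>\<^bsub>M\<^esub> munit n k k \<odot>\<^bsub>M\<^esub> x"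
          using smult_l_distr[OF D munit_LT xM, of k k k] by simp
        moreover have "g (x, k) \<in> N" using N x Suc by auto
        ultimately show ?case using Suc sub(3) by (simp add: g_def)
      qed
      have "D n = 1\<^sub>m n" by (auto simp: D_def intro!: eq_matI)
      then show ?thesis using smult_one[OF xM] Dk[of n] by simp
    qed
    then show "N = carrier M" using S(3) N by blast
  qed
  ultimately show ?thesis using S(1) by blast
qed

lemma barcode_if_generating:
  fixes X0 :: "'i set"
  assumes X0: "finite X0" and sn: "\<And>x. x \<in> X0 \<Longrightarrow> s x < n"
    and g1: "homogeneous X0 s g1" "generating X0 g1"
  shows "\<exists>X t. barcode n X s t \<and> lmod_iso (LT n) (barcode_module n X s t) M"
proof -
  let ?P = "\<lambda>g. homogeneous X0 s g \<and> generating X0 g"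
  let ?m = "\<lambda>g. \<Sum>x\<in>X0. card (orbit s g x)"
  have "?P g1" using g1 by simp
  \<comment> \<open>The index set and the starts stay fixed, so that \<open>exchange\<close> always
    yields another candidate.\<close>
  then have "\<exists>g. ?P g \<and> (\<forall>g'. ?P g' \<longrightarrow> ?m g \<le> ?m g')" by (rule ex_has_least_nat[where P = ?P and m = ?m])
  then obtain g where hg: "homogeneous X0 s g" and gen: "generating X0 g"
    and min: "\<And>g'. ?P g' \<Longrightarrow> ?m g \<le> ?m g'" by (elim exE conjE) simp
  \<comment> \<open>The minimal family may contain zeros, as an exchange can produce a zero
    generator; these give no bar.\<close>
  define X where "X = {x \<in> X0. g x \<noteq> \<zero>\<^bsub>M\<^esub>}"
  define t where "t x = Max (orbit s g x)" for x
  have XX0: "X \<subseteq> X0" and fX: "finite X" using X0 by (auto simp: X_def)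
  have gM: "g x \<in> carrier M" if "x \<in> X0" for x using hg that by (simp add: homogeneous_def)
  have gX: "g x \<in> carrier M" if "x \<in> X" for x using gM subsetD[OF XX0 that] .
  have gs: "munit n (s x) (s x) \<odot>\<^bsub>M\<^esub> g x = g x" if "x \<in> X0" for x
    using hg that by (simp add: homogeneous_def)
  have forb: "finite (orbit s g x)" for x by (rule finite_subset[of _ "{..<n}"]) (auto simp: orbit_def)
  have sorb: "s x \<in> orbit s g x" if "x \<in> X" for x
    using that gs[of x] sn[of x] by (auto simp: orbit_def X_def)
  have torb: "t x \<in> orbit s g x" if "x \<in> X" for x
    unfolding t_def using forb sorb[OF that] by (intro Max_in) auto
  have orb: "v \<in> orbit s g x \<longleftrightarrow> s x \<le> v \<and> v \<le> t x" if x: "x \<in> X" for x v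
  proof
    assume "v \<in> orbit s g x"
    then show "s x \<le> v \<and> v \<le> t x" using Max_ge[OF forb] by (simp add: t_def) (simp add: orbit_def)
  next
    assume "s x \<le> v \<and> v \<le> t x"
    then show "v \<in> orbit s g x"
      using orbit_down[OF gM torb[OF x], of v] x XX0 by blast
  qed
  interpret barcode "TYPE('a)" n X s t
  proof
    fix x assume "x \<in> X"
    then show "s x \<le> t x" "t x < n" using torb[of x] by (auto simp: orbit_def)
  qed (fact fX)
  \<comment> \<open>Paths that end beyond the bar factor through \<open>Suc (t x)\<close>, where the
    generator is already zero. If there is no such vertex, the matrix itself is zero.\<close>
  have vanish: "col_mat n (s x) f \<odot>\<^bsub>M\<^esub> g x = \<zero>\<^bsub>M\<^esub>"
    if x: "x \<in> X" and f: "\<And>r. r \<le> t x \<Longrightarrow> f r = 0" for x f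
  proof (cases "Suc (t x) < n")
    case True
    have "col_mat n (s x) f = col_mat n (Suc (t x)) f * munit n (Suc (t x)) (s x)"
      using True le[OF x] f by (intro col_mat_times_munit[symmetric]) auto
    then have "col_mat n (s x) f \<odot>\<^bsub>M\<^esub> g x =
        col_mat n (Suc (t x)) f \<odot>\<^bsub>M\<^esub> (munit n (Suc (t x)) (s x) \<odot>\<^bsub>M\<^esub> g x)"
      using le[OF x] by (subst smult_smult) (simp_all add: col_mat_LT munit_LT gX[OF x])
    moreover have "munit n (Suc (t x)) (s x) \<odot>\<^bsub>M\<^esub> g x = \<zero>\<^bsub>M\<^esub>"
      using orb[OF x, of "Suc (t x)"] True le[OF x] by (auto simp: orbit_def)
    ultimately show ?thesis by (simp add: smult_r_null col_mat_LT)
  next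
    case False
    then have "col_mat n (s x) f = 0\<^sub>m n n" using f by (intro col_mat_zero) auto
    then show ?thesis using smult_l_null[OF gX[OF x]] by simp
  qed
  define e where "e f x = col_mat n (s x) (f x) \<odot>\<^bsub>M\<^esub> g x" for f x
  have eM: "e f \<in> X \<rightarrow> carrier M" for f
    unfolding e_def by (intro funcsetI smult_closed col_mat_LT gX)
  \<comment> \<open>\<open>h\<close> sends the basis vector of the bar \<open>x\<close> at
    \<open>v\<close> to the translate of \<open>g x\<close> at \<open>v\<close>.\<close>
  define h where "h = (\<lambda>f\<in>carrier F. \<Oplus>\<^bsub>M\<^esub>x\<in>X. e f x)"
  have hM: "h f \<in> carrier M" if "f \<in> carrier F" for f
    using that eM by (simp add: h_def M.finsum_closed)
  have h_add: "h (f \<oplus>\<^bsub>F\<^esub> f') = h f \<oplus>\<^bsub>M\<^esub> h f'" if "f \<in> carrier F" "f' \<in> carrier F" for f f'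
  proof -
    have "e (f \<oplus>\<^bsub>F\<^esub> f') x = e f x \<oplus>\<^bsub>M\<^esub> e f' x" if "x \<in> X" for x
      using smult_l_distr[OF col_mat_LT col_mat_LT gX[OF that]] by (simp add: e_def col_mat_add)
    then have "(\<Oplus>\<^bsub>M\<^esub>x\<in>X. e (f \<oplus>\<^bsub>F\<^esub> f') x) = (\<Oplus>\<^bsub>M\<^esub>x\<in>X. e f x \<oplus>\<^bsub>M\<^esub> e f' x)"
      using eM by (intro M.finsum_cong') (auto simp: Pi_def)
    also have "\<dots> = (\<Oplus>\<^bsub>M\<^esub>x\<in>X. e f x) \<oplus>\<^bsub>M\<^esub> (\<Oplus>\<^bsub>M\<^esub>x\<in>X. e f' x)"
      using eM by (intro M.finsum_addf)
    finally show ?thesis using that F_add_closed[OF that] by (simp add: h_def)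
  qed
  have h_smult: "h (A \<odot>\<^bsub>F\<^esub> f) = A \<odot>\<^bsub>M\<^esub> h f" if A: "A \<in> carrier (LT n)" and f: "f \<in> carrier F" for A f
  proof -
    have "e (A \<odot>\<^bsub>F\<^esub> f) x = A \<odot>\<^bsub>M\<^esub> e f x" if x: "x \<in> X" for x
    proof -
      define f1 where "f1 = (\<lambda>r. \<Sum>q<n. A $$ (r, q) * f x q)"
      \<comment> \<open>This is the part of the product past the end of the bar. The barcode module
        truncates it, and in \<open>M\<close> it contributes zero by \<open>vanish\<close>.\<close>
      define f2 where "f2 = (\<lambda>r. if r \<le> t x then 0 else f1 r)"
      have "(\<Sum>q<n. A $$ (r, q) * (if s x \<le> q then f x q else 0)) = f1 r" for r
        unfolding f1_def using F_eq_0[OF f, of x] by (intro sum.cong) auto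
      then have "A * col_mat n (s x) (f x) = col_mat n (s x) f1"
        using mat_times_col_mat[OF A, of "s x" "f x"] by simp
      also have "\<dots> = col_mat n (s x) (\<lambda>r. (A \<odot>\<^bsub>F\<^esub> f) x r + f2 r)"
        using x by (auto simp: col_mat_def F_smult f1_def f2_def intro!: eq_matI)
      also have "\<dots> = col_mat n (s x) ((A \<odot>\<^bsub>F\<^esub> f) x) + col_mat n (s x) f2" by (rule col_mat_add)
      finally have "A \<odot>\<^bsub>M\<^esub> e f x = e (A \<odot>\<^bsub>F\<^esub> f) x \<oplus>\<^bsub>M\<^esub> col_mat n (s x) f2 \<odot>\<^bsub>M\<^esub> g x"
        using smult_l_distr[OF col_mat_LT col_mat_LT gX[OF x]] smult_smult[OF A col_mat_LT gX[OF x]]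
        by (simp add: e_def)
      then show ?thesis
        using vanish[OF x, of f2] M.r_zero[OF funcset_mem[OF eM x], of "A \<odot>\<^bsub>F\<^esub> f"]
        by (simp add: f2_def)
    qed
    then have "(\<Oplus>\<^bsub>M\<^esub>x\<in>X. e (A \<odot>\<^bsub>F\<^esub> f) x) = (\<Oplus>\<^bsub>M\<^esub>x\<in>X. A \<odot>\<^bsub>M\<^esub> e f x)"
      using eM[of f] A by (intro M.finsum_cong') (auto intro!: smult_closed)
    also have "\<dots> = A \<odot>\<^bsub>M\<^esub> (\<Oplus>\<^bsub>M\<^esub>x\<in>X. e f x)" by (rule smult_finsum[OF fX A eM, symmetric])
    finally show ?thesis using f F_smult_closed by (simp add: h_def)
  qed
  have hom: "h \<in> lmod_hom (LT n) F M"
    using hM h_add h_smult by (auto simp: lmod_hom_def) (auto simp: h_def)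
  have h_zero: "h (\<lambda>x v. 0) = \<zero>\<^bsub>M\<^esub>"
  proof -
    have "(\<Oplus>\<^bsub>M\<^esub>x\<in>X. e (\<lambda>x v. 0) x) = (\<Oplus>\<^bsub>M\<^esub>x\<in>X. \<zero>\<^bsub>M\<^esub>)"
      by (intro M.finsum_cong') (auto simp: e_def vanish)
    then show ?thesis using F_zero_mem by (simp add: h_def)
  qed
  have ker: "f = (\<lambda>x v. 0)" if f: "f \<in> carrier F" and hf: "h f = \<zero>\<^bsub>M\<^esub>" for f
  proof (rule ccontr)
    assume "f \<noteq> (\<lambda>x v. 0)"
    then obtain x1 v where nz: "f x1 v \<noteq> 0" by (auto simp: fun_eq_iff)
    \<comment> \<open>The idempotent at \<open>v\<close> isolates the coefficients at one vertex.
      The nonzero ones form a relation between nonzero translates, which \<open>exchange\<close>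
      excludes for a minimal family.\<close>
    define Y where "Y = {x \<in> X. f x v \<noteq> 0}"
    have vY: "v \<in> orbit s g x" if "x \<in> Y" for x
      using that orb[of x v] F_eq_0[OF f, of x v] by (auto simp: Y_def)
    have x1: "x1 \<in> Y" using nz F_eq_0[OF f, of x1 v] by (auto simp: Y_def)
    have vn: "v < n" using vY[OF x1] by (simp add: orbit_def)
    let ?d = "\<lambda>x. col_mat n (s x) (\<lambda>r. if r = v then f x v else 0) \<odot>\<^bsub>M\<^esub> g x"
    have dM: "?d \<in> X \<rightarrow> carrier M" by (intro funcsetI smult_closed col_mat_LT gX)
    have "munit n v v \<odot>\<^bsub>M\<^esub> e f x = ?d x" if "x \<in> X" for x
      using vn by (simp add: e_def smult_smult munit_LT col_mat_LT munit_times_col_mat gX[OF that])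
    then have "(\<Oplus>\<^bsub>M\<^esub>x\<in>X. ?d x) = (\<Oplus>\<^bsub>M\<^esub>x\<in>X. munit n v v \<odot>\<^bsub>M\<^esub> e f x)"
      using eM[of f] by (intro M.finsum_cong') (auto intro!: smult_closed munit_LT)
    also have "\<dots> = munit n v v \<odot>\<^bsub>M\<^esub> h f"
      using smult_finsum[OF fX munit_LT eM, of v v f] f by (simp add: h_def)
    also have "\<dots> = \<zero>\<^bsub>M\<^esub>" by (simp add: hf smult_r_null munit_LT)
    finally have sumX: "(\<Oplus>\<^bsub>M\<^esub>x\<in>X. ?d x) = \<zero>\<^bsub>M\<^esub>" .
    have "(\<Oplus>\<^bsub>M\<^esub>x\<in>Y. ?d x) = (\<Oplus>\<^bsub>M\<^esub>x\<in>X. ?d x)"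
    proof (rule M.add.finprod_mono_neutral_cong_left)
      fix x assume "x \<in> X - Y"
      then show "?d x = \<zero>\<^bsub>M\<^esub>" by (intro vanish) (auto simp: Y_def)
    qed (use fX dM in \<open>auto simp: Y_def\<close>)
    then have rel: "(\<Oplus>\<^bsub>M\<^esub>x\<in>Y. ?d x) = \<zero>\<^bsub>M\<^esub>" using sumX by simp
    have Y: "Y \<subseteq> X0" "Y \<noteq> {}" using x1 XX0 unfolding Y_def by blast+
    have fY: "f x v \<noteq> 0" if "x \<in> Y" for x using that by (simp add: Y_def)
    obtain g' where g': "homogeneous X0 s g'" "generating X0 g'" "?m g' < ?m g"
      using exchange[where c = "\<lambda>x. f x v", OF X0 sn hg gen Y vY fY rel] by blast
    from min[OF conjI[OF g'(1,2)]] g'(3) show False by simp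
  qed
  have "inj_on h (carrier F)"
  proof (rule inj_onI)
    fix f f' assume f: "f \<in> carrier F" "f' \<in> carrier F" and eq: "h f = h f'"
    let ?d = "\<lambda>x v. f x v - f' x v"
    have d: "?d \<in> carrier F"
      unfolding mem_F
    proof (intro allI impI)
      fix x v assume "f x v - f' x v \<noteq> 0"
      then show "x \<in> X \<and> s x \<le> v \<and> v \<le> t x"
        using F_eq_0[OF f(1), of x v] F_eq_0[OF f(2), of x v] by fastforce
    qed
    have "?d \<oplus>\<^bsub>F\<^esub> f' = f" by simp
    then have "h ?d \<oplus>\<^bsub>M\<^esub> h f' = h f'" using h_add[OF d f(2)] eq by simp
    then have "h ?d = \<zero>\<^bsub>M\<^esub>" using M.add.r_cancel_one[OF hM[OF f(2)] hM[OF d]] by simp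
    from fun_cong[OF fun_cong[OF ker[OF d this]]] show "f = f'" by (intro ext) simp
  qed
  moreover have "h ` carrier F = carrier M"
  proof -
    have "submodule (h ` carrier F) (LT n) M"
    proof (rule submoduleI)
      show "h ` carrier F \<subseteq> carrier M" using hM by blast
      show "\<zero>\<^bsub>M\<^esub> \<in> h ` carrier F" using imageI[OF F_zero_mem, of h] h_zero by simp
      show "x \<oplus>\<^bsub>M\<^esub> y \<in> h ` carrier F" if "x \<in> h ` carrier F" "y \<in> h ` carrier F" for x y
        using that by (auto simp: h_add[symmetric] simp del: F_simps intro!: imageI F_add_closed)
      show "A \<odot>\<^bsub>M\<^esub> x \<in> h ` carrier F" if "A \<in> carrier (LT n)" "x \<in> h ` carrier F" for A x
        using that by (auto simp: h_smult[symmetric] intro!: imageI F_smult_closed)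
    qed
    \<comment> \<open>The generator of a bar is the image of the basis vector at its start.\<close>
    moreover have "g x \<in> h ` carrier F" if x: "x \<in> X0" for x
    proof (cases "g x = \<zero>\<^bsub>M\<^esub>")
      case True
      then show ?thesis using imageI[OF F_zero_mem, of h] h_zero by simp
    next
      case False
      then have xX: "x \<in> X" using x by (simp add: X_def)
      have mem: "single x (s x) 1 \<in> carrier F" using le[OF xX] by (intro single_mem[OF xX]) auto
      have "e (single x (s x) 1) y = (if x = y then g y else \<zero>\<^bsub>M\<^esub>)" if y: "y \<in> X" for y
      proof (cases "y = x")
        case True
        have "col_mat n (s x) (single x (s x) 1 x) = (munit n (s x) (s x) :: 'a mat)"
          by (simp add: munit_eq_col_mat single_def)
        then show ?thesis using True gs[OF x] by (simp add: e_def)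
      next
        case False
        then have "e (single x (s x) 1) y = \<zero>\<^bsub>M\<^esub>"
          unfolding e_def by (intro vanish[OF y]) (simp add: single_def)
        then show ?thesis using False by simp
      qed
      then have "(\<Oplus>\<^bsub>M\<^esub>y\<in>X. e (single x (s x) 1) y) = (\<Oplus>\<^bsub>M\<^esub>y\<in>X. if x = y then g y else \<zero>\<^bsub>M\<^esub>)"
        by (intro M.finsum_cong') (auto simp: gX)
      also have "\<dots> = g x"
        by (intro M.add.finprod_singleton[OF xX fX]) (auto simp: gX)
      finally have "h (single x (s x) 1) = g x" using mem by (simp add: h_def)
      then show ?thesis using imageI[OF mem, of h] by simp
    qed
    ultimately show ?thesis using gen unfolding generating_def by blast
  qed
  ultimately have "lmod_iso (LT n) F M"
    unfolding lmod_iso_def bij_betw_def using hom by blast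
  then show ?thesis using barcode_axioms by blast
qed

lemma barcode_decomposition:
  assumes fg: "finitely_generated (LT n) M"
  shows "\<exists>(X :: ('b \<times> nat) set) s t. barcode n X s t \<and> lmod_iso (LT n) (barcode_module n X s t) M"
proof -
  obtain S :: "'b set" and g where S: "finite S" "homogeneous (S \<times> {..<n}) snd g" "generating (S \<times> {..<n}) g"
    using homogeneous_generating_exists[OF fg] by blast
  have "finite (S \<times> {..<n})" "\<And>x. x \<in> S \<times> {..<n} \<Longrightarrow> snd x < n" using S(1) by auto
  from barcode_if_generating[OF this S(2,3)] show ?thesis by blast
qed

end

section \<open>Transport along isomorphisms\<close>

lemma lmod_iso_inverse:
  assumes "left_module R M" and "lmod_iso R M N"
  shows "\<exists>h k. h \<in> lmod_hom R M N \<and> k \<in> lmod_hom R N M \<and>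
    (\<forall>x\<in>carrier M. k (h x) = x) \<and> (\<forall>y\<in>carrier N. h (k y) = y)"
proof -
  interpret M: left_module R M by (rule assms(1))
  obtain h where h: "h \<in> lmod_hom R M N" "bij_betw h (carrier M) (carrier N)"
    using assms(2) unfolding lmod_iso_def by blast
  define k where "k = restrict (inv_into (carrier M) h) (carrier N)"
  have k: "k y \<in> carrier M" "h (k y) = y" if "y \<in> carrier N" for y
    using that h(2) by (auto simp: k_def bij_betw_def inv_into_into f_inv_into_f)
  have kh: "k (h x) = x" if "x \<in> carrier M" for x
    using that h(2) by (auto simp: k_def bij_betw_def)
  have hN: "h x \<in> carrier N" if "x \<in> carrier M" for x
    using that h(2) by (auto simp: bij_betw_def)
  have "k (y \<oplus>\<^bsub>N\<^esub> y') = k y \<oplus>\<^bsub>M\<^esub> k y'" if "y \<in> carrier N" "y' \<in> carrier N" for y y'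
  proof -
    have "h (k y \<oplus>\<^bsub>M\<^esub> k y') = y \<oplus>\<^bsub>N\<^esub> y'" using h(1) that k by (simp add: lmod_hom_def)
    then show ?thesis using kh[OF M.M.a_closed] k that by metis
  qed
  moreover have "k (a \<odot>\<^bsub>N\<^esub> y) = a \<odot>\<^bsub>M\<^esub> k y" if "a \<in> carrier R" "y \<in> carrier N" for a y
  proof -
    have "h (a \<odot>\<^bsub>M\<^esub> k y) = a \<odot>\<^bsub>N\<^esub> y" using h(1) that k by (simp add: lmod_hom_def)
    then show ?thesis using kh[OF M.smult_closed] k that by metis
  qed
  ultimately have "k \<in> lmod_hom R N M"
    using k by (auto simp: lmod_hom_def) (auto simp: k_def)
  then show ?thesis using h(1) k kh by blast
qed

lemma lmod_homD:
  assumes "h \<in> lmod_hom R M N"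
  shows "x \<in> carrier M \<Longrightarrow> h x \<in> carrier N"
    and "x \<in> carrier M \<Longrightarrow> y \<in> carrier M \<Longrightarrow> h (x \<oplus>\<^bsub>M\<^esub> y) = h x \<oplus>\<^bsub>N\<^esub> h y"
    and "a \<in> carrier R \<Longrightarrow> x \<in> carrier M \<Longrightarrow> h (a \<odot>\<^bsub>M\<^esub> x) = a \<odot>\<^bsub>N\<^esub> h x"
  using assms by (auto simp: lmod_hom_def)

lemma lmod_iso_sym:
  assumes "left_module R M" and "lmod_iso R M N"
  shows "lmod_iso R N M"
proof -
  obtain h k where hk: "h \<in> lmod_hom R M N" "k \<in> lmod_hom R N M"
      "\<forall>x\<in>carrier M. k (h x) = x" "\<forall>y\<in>carrier N. h (k y) = y"
    using lmod_iso_inverse[OF assms] by blast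
  have "bij_betw k (carrier N) (carrier M)"
    by (rule bij_betwI[of _ _ _ h]) (use hk lmod_homD(1)[OF hk(1)] lmod_homD(1)[OF hk(2)] in auto)
  then show ?thesis unfolding lmod_iso_def using hk(2) by blast
qed

text \<open>Each axiom is compared after applying the injective map \<open>h\<close>. This gives the
  barcode module its axioms from those of \<open>M\<close>.\<close>

lemma left_module_transport:
  assumes N: "left_module R N" and iso: "lmod_iso R M N" and M: "abelian_group M"
    and smult: "\<And>a x. a \<in> carrier R \<Longrightarrow> x \<in> carrier M \<Longrightarrow> a \<odot>\<^bsub>M\<^esub> x \<in> carrier M"
  shows "left_module R M"
proof -
  interpret N: left_module R N by (rule N)
  interpret M: abelian_group M by (rule M)
  obtain h where h: "h \<in> lmod_hom R M N" "bij_betw h (carrier M) (carrier N)"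
    using iso unfolding lmod_iso_def by blast
  note hom = lmod_homD[OF h(1)]
  have inj: "x = y" if "h x = h y" "x \<in> carrier M" "y \<in> carrier M" for x y
    using h(2) that by (auto simp: bij_betw_def inj_on_def)
  show ?thesis
  proof (intro left_module.intro left_module_axioms.intro M N.R.ring_axioms)
    fix a b x y assume a: "a \<in> carrier R" and x: "x \<in> carrier M"
    show "a \<odot>\<^bsub>M\<^esub> x \<in> carrier M" using a x by (rule smult)
    show "a \<odot>\<^bsub>M\<^esub> (x \<oplus>\<^bsub>M\<^esub> y) = a \<odot>\<^bsub>M\<^esub> x \<oplus>\<^bsub>M\<^esub> a \<odot>\<^bsub>M\<^esub> y" if "y \<in> carrier M"
      using a x that by (intro inj) (simp_all add: hom smult N.smult_r_distr)
    assume b: "b \<in> carrier R"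
    show "(a \<oplus>\<^bsub>R\<^esub> b) \<odot>\<^bsub>M\<^esub> x = a \<odot>\<^bsub>M\<^esub> x \<oplus>\<^bsub>M\<^esub> b \<odot>\<^bsub>M\<^esub> x"
      using a b x by (intro inj) (simp_all add: hom smult N.smult_l_distr)
    show "(a \<otimes>\<^bsub>R\<^esub> b) \<odot>\<^bsub>M\<^esub> x = a \<odot>\<^bsub>M\<^esub> (b \<odot>\<^bsub>M\<^esub> x)"
      using a b x by (intro inj) (simp_all add: hom smult N.smult_assoc)
  next
    fix x assume x: "x \<in> carrier M"
    then show "\<one>\<^bsub>R\<^esub> \<odot>\<^bsub>M\<^esub> x = x"
      by (intro inj) (simp_all add: hom smult N.smult_one)
  qed
qed

text \<open>Conjugation by the isomorphism carries endomorphisms to endomorphisms, hence the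
  bicommutant to the bicommutant, and it respects the action.\<close>

lemma faithfully_balanced_transport:
  assumes M: "left_module R M" and N: "left_module R N" and iso: "lmod_iso R M N"
    and fb: "faithfully_balanced R M"
  shows "faithfully_balanced R N"
proof -
  interpret M: left_module R M by (rule M)
  interpret N: left_module R N by (rule N)
  obtain h k where hk: "h \<in> lmod_hom R M N" "k \<in> lmod_hom R N M"
      "\<forall>x\<in>carrier M. k (h x) = x" "\<forall>y\<in>carrier N. h (k y) = y"
    using lmod_iso_inverse[OF M iso] by blast
  note h = lmod_homD[OF hk(1)] and k = lmod_homD[OF hk(2)]
  have M_iff: "\<And>a b. a \<in> carrier R \<Longrightarrow> b \<in> carrier R \<Longrightarrow>
        (\<And>x. x \<in> carrier M \<Longrightarrow> a \<odot>\<^bsub>M\<^esub> x = b \<odot>\<^bsub>M\<^esub> x) \<Longrightarrow> a = b"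
      "\<And>\<phi>. bicommutant R M \<phi> \<Longrightarrow> \<exists>a\<in>carrier R. \<forall>x\<in>carrier M. \<phi> x = a \<odot>\<^bsub>M\<^esub> x"
    using iffD1[OF M.faithfully_balanced_iff fb] by simp_all
  show ?thesis
    unfolding N.faithfully_balanced_iff
  proof (intro conjI ballI allI impI)
    fix a b assume ab: "a \<in> carrier R" "b \<in> carrier R"
      and eq: "\<forall>y\<in>carrier N. a \<odot>\<^bsub>N\<^esub> y = b \<odot>\<^bsub>N\<^esub> y"
    show "a = b"
    proof (rule M_iff(1)[OF ab])
      fix x assume x: "x \<in> carrier M"
      then have "k (h (a \<odot>\<^bsub>M\<^esub> x)) = k (h (b \<odot>\<^bsub>M\<^esub> x))" using ab eq h by simp
      then show "a \<odot>\<^bsub>M\<^esub> x = b \<odot>\<^bsub>M\<^esub> x"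
        using hk(3) M.smult_closed[OF ab(1) x] M.smult_closed[OF ab(2) x] by simp
    qed
  next
    fix \<phi> assume \<phi>: "bicommutant R N \<phi>"
    then have \<phi>_mem: "\<And>y. y \<in> carrier N \<Longrightarrow> \<phi> y \<in> carrier N"
      and \<phi>_add: "\<And>x y. x \<in> carrier N \<Longrightarrow> y \<in> carrier N \<Longrightarrow> \<phi> (x \<oplus>\<^bsub>N\<^esub> y) = \<phi> x \<oplus>\<^bsub>N\<^esub> \<phi> y"
      and \<phi>_endo: "\<And>f y. lmod_endo R N f \<Longrightarrow> y \<in> carrier N \<Longrightarrow> \<phi> (f y) = f (\<phi> y)"
      by (simp_all add: bicommutant_def)
    have "bicommutant R M (\<lambda>x. k (\<phi> (h x)))"
      unfolding bicommutant_def
    proof (intro conjI ballI allI impI)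
      fix f x assume f: "lmod_endo R M f" and x: "x \<in> carrier M"
      have "lmod_endo R N (\<lambda>y. h (f (k y)))"
        unfolding lmod_endo_def using f[unfolded lmod_endo_def] by (simp add: h k)
      from \<phi>_endo[OF this, of "h x"] show "k (\<phi> (h (f x))) = f (k (\<phi> (h x)))"
        using f x h(1) hk(3) k(1) \<phi>_mem by (simp add: lmod_endo_def)
    qed (simp_all add: h k \<phi>_mem \<phi>_add)
    then obtain a where a: "a \<in> carrier R" "\<forall>x\<in>carrier M. k (\<phi> (h x)) = a \<odot>\<^bsub>M\<^esub> x"
      using M_iff(2) by blast
    have "\<phi> y = a \<odot>\<^bsub>N\<^esub> y" if y: "y \<in> carrier N" for y
    proof -
      have "h (k (\<phi> (h (k y)))) = h (a \<odot>\<^bsub>M\<^esub> k y)" using a(2) k(1)[OF y] by simp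
      then show ?thesis using y h(3)[OF a(1) k(1)[OF y]] hk(4) \<phi>_mem by simp
    qed
    then show "\<exists>a\<in>carrier R. \<forall>y\<in>carrier N. \<phi> y = a \<odot>\<^bsub>N\<^esub> y" using a(1) by blast
  qed
qed

text \<open>Closure of \<open>L\<close> under its operations is assumed because the composed
  isomorphism is extensional on \<open>L\<close>, so it can be evaluated at sums and multiples only
  inside the carrier.\<close>

lemma is_summand_transport:
  assumes M: "left_module R M" and N: "left_module R N" and iso: "lmod_iso R M N"
    and L_add: "\<And>x y. x \<in> carrier L \<Longrightarrow> y \<in> carrier L \<Longrightarrow> x \<oplus>\<^bsub>L\<^esub> y \<in> carrier L"
    and L_smult: "\<And>a x. a \<in> carrier R \<Longrightarrow> x \<in> carrier L \<Longrightarrow> a \<odot>\<^bsub>L\<^esub> x \<in> carrier L"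
    and sm: "is_summand R L M"
  shows "is_summand R L N"
proof -
  interpret M: left_module R M by (rule M)
  interpret N: left_module R N by (rule N)
  obtain h where h: "h \<in> lmod_hom R M N" "bij_betw h (carrier M) (carrier N)"
    using iso unfolding lmod_iso_def by blast
  have hN: "h x \<in> carrier N" if "x \<in> carrier M" for x
    using that h(2) by (auto simp: bij_betw_def)
  have h_add: "h (x \<oplus>\<^bsub>M\<^esub> y) = h x \<oplus>\<^bsub>N\<^esub> h y" if "x \<in> carrier M" "y \<in> carrier M" for x y
    using h(1) that by (simp add: lmod_hom_def)
  have h_smult: "h (a \<odot>\<^bsub>M\<^esub> x) = a \<odot>\<^bsub>N\<^esub> h x" if "x \<in> carrier M" "a \<in> carrier R" for x a
    using h(1) that by (simp add: lmod_hom_def)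
  have h_zero: "h \<zero>\<^bsub>M\<^esub> = \<zero>\<^bsub>N\<^esub>"
    using h_add[of "\<zero>\<^bsub>M\<^esub>" "\<zero>\<^bsub>M\<^esub>"] hN[of "\<zero>\<^bsub>M\<^esub>"] by (simp add: N.M.add.r_cancel_one')
  have inj: "x = y" if "h x = h y" "x \<in> carrier M" "y \<in> carrier M" for x y
    using h(2) that by (auto simp: bij_betw_def inj_on_def)
  obtain U V f where UV: "submodule U R M" "submodule V R M" "U \<inter> V = {\<zero>\<^bsub>M\<^esub>}"
      "U <+>\<^bsub>M\<^esub> V = carrier M" and f: "f \<in> lmod_hom R L (M\<lparr>carrier := U\<rparr>)" "bij_betw f (carrier L) U"
    using sm unfolding is_summand_def lmod_iso_def by auto
  have sub: "submodule (h ` H) R N" if H: "submodule H R M" for H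
  proof (rule N.submoduleI)
    have *: "H \<subseteq> carrier M" "\<zero>\<^bsub>M\<^esub> \<in> H" "\<And>x y. x \<in> H \<Longrightarrow> y \<in> H \<Longrightarrow> x \<oplus>\<^bsub>M\<^esub> y \<in> H"
      "\<And>a x. a \<in> carrier R \<Longrightarrow> x \<in> H \<Longrightarrow> a \<odot>\<^bsub>M\<^esub> x \<in> H"
      using H by (auto simp: submodule_def subgroup_def submodule_axioms_def)
    show "h ` H \<subseteq> carrier N" using * hN by blast
    show "\<zero>\<^bsub>N\<^esub> \<in> h ` H" using * h_zero by (metis imageI)
    show "x \<oplus>\<^bsub>N\<^esub> y \<in> h ` H" if "x \<in> h ` H" "y \<in> h ` H" for x y
      using that * by (auto simp: h_add[symmetric] subset_iff)
    show "a \<odot>\<^bsub>N\<^esub> x \<in> h ` H" if "a \<in> carrier R" "x \<in> h ` H" for a x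
      using that * by (auto simp: h_smult[symmetric] subset_iff)
  qed
  have UM: "U \<subseteq> carrier M" and VM: "V \<subseteq> carrier M"
    using UV by (auto simp: submodule_def subgroup_def)
  have "h ` U \<inter> h ` V = h ` (U \<inter> V)"
    using inj UM VM by blast
  then have int: "h ` U \<inter> h ` V = {\<zero>\<^bsub>N\<^esub>}" using UV(3) h_zero by simp
  have sum: "h ` U <+>\<^bsub>N\<^esub> h ` V = carrier N"
  proof -
    have "h ` U <+>\<^bsub>N\<^esub> h ` V = h ` (U <+>\<^bsub>M\<^esub> V)"
      unfolding set_add_def' using UM VM by (force simp: h_add subset_iff)
    then show ?thesis using UV(4) h(2) by (simp add: bij_betw_def)
  qed
  have fU: "f x \<in> U" if "x \<in> carrier L" for x using f(2) that by (auto simp: bij_betw_def)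
  have "compose (carrier L) h f \<in> lmod_hom R L (N\<lparr>carrier := h ` U\<rparr>)"
    unfolding lmod_hom_def
  proof (intro CollectI conjI ballI)
    show "compose (carrier L) h f \<in> carrier L \<rightarrow>\<^sub>E carrier (N\<lparr>carrier := h ` U\<rparr>)"
      using fU by (auto simp: compose_def)
    fix x assume x: "x \<in> carrier L"
    show "compose (carrier L) h f (x \<oplus>\<^bsub>L\<^esub> y) =
        compose (carrier L) h f x \<oplus>\<^bsub>N\<lparr>carrier := h ` U\<rparr>\<^esub> compose (carrier L) h f y"
      if "y \<in> carrier L" for y
      using L_add[OF x that] x that f(1) h_add[of "f x" "f y"] fU UM by (auto simp: lmod_hom_def compose_def)
    show "compose (carrier L) h f (a \<odot>\<^bsub>L\<^esub> x) = a \<odot>\<^bsub>N\<lparr>carrier := h ` U\<rparr>\<^esub> compose (carrier L) h f x"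
      if "a \<in> carrier R" for a
      using L_smult[OF that x] x that f(1) h_smult[of "f x" a] fU UM by (auto simp: lmod_hom_def compose_def)
  qed
  moreover have "bij_betw (compose (carrier L) h f) (carrier L) (h ` U)"
  proof -
    have "bij_betw h U (h ` U)" using h(2) UM by (auto simp: bij_betw_def inj_on_def)
    then have "bij_betw (h \<circ> f) (carrier L) (h ` U)" using f(2) bij_betw_trans by blast
    then show ?thesis by (rule bij_betw_cong[THEN iffD1, rotated]) (simp add: compose_def)
  qed
  ultimately have "lmod_iso R L (N\<lparr>carrier := h ` U\<rparr>)" unfolding lmod_iso_def by auto
  then show ?thesis unfolding is_summand_def using sub UV int sum by blast
qed

section \<open>Translation of the cohook conditions into statements about bars\<close>

lemma cohook_summand_iff:
  "(\<exists>N\<in>cohook n (Suc i) j. is_summand R N M) \<longleftrightarrow>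
    (\<exists>k<i. is_summand R (interval_module n (Suc k) j) M) \<or>
    (\<exists>l<n. j \<le> l \<and> is_summand R (interval_module n (Suc i) (Suc l)) M)" (is "?l \<longleftrightarrow> ?r")
proof
  assume ?l
  then consider k where "1 \<le> k" "k < Suc i" "is_summand R (interval_module n k j) M"
    | l where "j < l" "l \<le> n" "is_summand R (interval_module n (Suc i) l) M"
    unfolding cohook_def by blast
  then show ?r
  proof cases
    case 1
    then show ?thesis by (cases k) auto
  next
    case 2
    then show ?thesis by (cases l) auto
  qed
next
  assume ?r
  then show ?l
  proof
    assume "\<exists>k<i. is_summand R (interval_module n (Suc k) j) M"
    then obtain k where "k < i" "is_summand R (interval_module n (Suc k) j) M" by blast
    moreover have "interval_module n (Suc k) j \<in> cohook n (Suc i) j"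
      using \<open>k < i\<close> unfolding cohook_def by fastforce
    ultimately show ?l by blast
  next
    assume "\<exists>l<n. j \<le> l \<and> is_summand R (interval_module n (Suc i) (Suc l)) M"
    then obtain l where "l < n" "j \<le> l" "is_summand R (interval_module n (Suc i) (Suc l)) M" by blast
    moreover have "interval_module n (Suc i) (Suc l) \<in> cohook n (Suc i) j"
      using \<open>l < n\<close> \<open>j \<le> l\<close> unfolding cohook_def by fastforce
    ultimately show ?l by blast
  qed
qed

text \<open>The interval summands of \<open>M\<close> are exactly the bars, with indices shifted by
  one, so each condition becomes a condition on \<open>X\<close>.\<close>

lemma (in barcode) faithfully_balanced_iff_summands:
  assumes n: "n \<ge> 1" and M: "left_module (LT n) M" and iso: "lmod_iso (LT n) F M"
  shows "faithfully_balanced (LT n) M \<longleftrightarrow>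
      is_summand (LT n) (interval_module n 1 n) M \<and>
      (\<forall>i j. 1 \<le> i \<and> i \<le> j \<and> j \<le> n \<and> (i, j) \<noteq> (1, n) \<and>
          is_summand (LT n) (interval_module n i j) M \<longrightarrow>
          (\<exists>N \<in> cohook n i j. is_summand (LT n) N M)) \<and>
      (\<forall>i \<in> {1..n + 1}. \<exists>N \<in> cohook n i (i - 1). is_summand (LT n) N M)"
proof -
  interpret M: left_module "LT n" M by (rule M)
  have F: "left_module (LT n) F"
    by (rule left_module_transport[OF M iso F_abelian_group F_smult_closed])
  have iso': "lmod_iso (LT n) M F"
    by (rule lmod_iso_sym[OF F iso])
  have fb: "faithfully_balanced (LT n) M \<longleftrightarrow> faithfully_balanced (LT n) F"
    using faithfully_balanced_transport[OF M F iso'] faithfully_balanced_transport[OF F M iso] by blast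
  have sm: "is_summand (LT n) (interval_module n (Suc i) (Suc j)) M \<longleftrightarrow> (\<exists>x\<in>X. s x = i \<and> t x = j)"
    if "i \<le> j" "j < n" for i j
  proof -
    let ?L = "interval_module n (Suc i) (Suc j) :: ('a mat, 'a vec) module"
    have "is_summand (LT n) ?L M \<longleftrightarrow> is_summand (LT n) ?L F"
    proof
      assume "is_summand (LT n) ?L M"
      then show "is_summand (LT n) ?L F"
        by (rule is_summand_transport[OF M F iso', rotated 2])
          (simp_all add: interval_add_closed interval_smult_closed)
    next
      assume "is_summand (LT n) ?L F"
      then show "is_summand (LT n) ?L M"
        by (rule is_summand_transport[OF F M iso, rotated 2])
          (simp_all add: interval_add_closed interval_smult_closed)
    qed
    also have "\<dots> \<longleftrightarrow> (\<exists>x\<in>X. s x = i \<and> t x = j)"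
    proof
      assume "is_summand (LT n) ?L F"
      then show "\<exists>x\<in>X. s x = i \<and> t x = j" by (rule bar_if_interval_summand[OF that])
    next
      assume "\<exists>x\<in>X. s x = i \<and> t x = j"
      then show "is_summand (LT n) ?L F" using interval_summand_if_bar by auto
    qed
    finally show ?thesis .
  qed
  let ?c = "\<lambda>x y. s y < s x \<and> t y = t x \<or> s y = s x \<and> t x < t y"
  have full: "is_summand (LT n) (interval_module n 1 n) M \<longleftrightarrow> (\<exists>z\<in>X. s z = 0 \<and> t z = n - 1)"
    using sm[of 0 "n - 1"] n by simp
  have co: "(\<exists>N\<in>cohook n (Suc i) (Suc j). is_summand (LT n) N M) \<longleftrightarrow>
      (\<exists>y\<in>X. s y < i \<and> t y = j \<or> s y = i \<and> j < t y)" if "i \<le> j" "j < n" for i j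
  proof -
    have "(\<exists>k<i. is_summand (LT n) (interval_module n (Suc k) (Suc j)) M) \<longleftrightarrow> (\<exists>y\<in>X. s y < i \<and> t y = j)"
    proof -
      have "is_summand (LT n) (interval_module n (Suc k) (Suc j)) M \<longleftrightarrow> (\<exists>y\<in>X. s y = k \<and> t y = j)"
        if "k < i" for k
        using that \<open>i \<le> j\<close> \<open>j < n\<close> by (intro sm) auto
      then show ?thesis by (simp cong: conj_cong) blast
    qed
    moreover have "(\<exists>l<n. Suc j \<le> l \<and> is_summand (LT n) (interval_module n (Suc i) (Suc l)) M) \<longleftrightarrow>
        (\<exists>y\<in>X. s y = i \<and> j < t y)"
    proof -
      have "is_summand (LT n) (interval_module n (Suc i) (Suc l)) M \<longleftrightarrow> (\<exists>y\<in>X. s y = i \<and> t y = l)"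
        if "l < n" "j < l" for l
        using that \<open>i \<le> j\<close> by (intro sm) auto
      then show ?thesis using less by (simp add: Suc_le_eq cong: conj_cong) blast
    qed
    ultimately show ?thesis unfolding cohook_summand_iff by blast
  qed
  have fb1: "(\<forall>i j. 1 \<le> i \<and> i \<le> j \<and> j \<le> n \<and> (i, j) \<noteq> (1, n) \<and>
        is_summand (LT n) (interval_module n i j) M \<longrightarrow>
        (\<exists>N\<in>cohook n i j. is_summand (LT n) N M)) \<longleftrightarrow>
      (\<forall>x\<in>X. (s x, t x) \<noteq> (0, n - 1) \<longrightarrow> (\<exists>y\<in>X. ?c x y))" (is "?l \<longleftrightarrow> ?r")
  proof
    assume l: ?l
    show ?r
    proof (intro ballI impI)
      fix x assume x: "x \<in> X" "(s x, t x) \<noteq> (0, n - 1)"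
      have "(Suc (s x), Suc (t x)) \<noteq> (1, n)" using x(2) by auto
      then have "\<exists>N\<in>cohook n (Suc (s x)) (Suc (t x)). is_summand (LT n) N M"
        using l[rule_format, of "Suc (s x)" "Suc (t x)"] sm[OF le[OF x(1)] less[OF x(1)]]
          le[OF x(1)] less[OF x(1)] x(1) by auto
      then show "\<exists>y\<in>X. ?c x y" using co le[OF x(1)] less[OF x(1)] by simp
    qed
  next
    assume r: ?r
    show ?l
    proof (intro allI impI)
      fix i j assume ij: "1 \<le> i \<and> i \<le> j \<and> j \<le> n \<and> (i, j) \<noteq> (1, n) \<and>
        is_summand (LT n) (interval_module n i j) M"
      then obtain i' j' where eq: "i = Suc i'" "j = Suc j'" by (cases i; cases j) auto
      have "i' \<le> j'" "j' < n" using ij eq by auto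
      moreover from this obtain x where x: "x \<in> X" "s x = i'" "t x = j'"
        using sm[of i' j'] ij eq by auto
      moreover have "(s x, t x) \<noteq> (0, n - 1)" using ij eq x n by auto
      then have "\<exists>y\<in>X. ?c x y" using r x(1) by blast
      ultimately show "\<exists>N\<in>cohook n i j. is_summand (LT n) N M"
        using co[of i' j'] eq by simp
    qed
  qed
  \<comment> \<open>A member of this virtual cohook ends just before vertex \<open>i\<close> or
    starts at it. The bound on its other endpoint is automatic, because a bar does not end before it
    starts.\<close>
  have vco: "(\<exists>N\<in>cohook n (Suc i) i. is_summand (LT n) N M) \<longleftrightarrow>
      (\<exists>y\<in>X. Suc (t y) = i \<or> s y = i)" if i: "i \<le> n" for i
  proof -
    have "(\<exists>k<i. is_summand (LT n) (interval_module n (Suc k) i) M) \<longleftrightarrow> (\<exists>y\<in>X. Suc (t y) = i)"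
    proof (cases i)
      case (Suc j)
      have "is_summand (LT n) (interval_module n (Suc k) (Suc j)) M \<longleftrightarrow> (\<exists>y\<in>X. s y = k \<and> t y = j)"
        if "k \<le> j" for k
        using that i Suc by (intro sm) auto
      then show ?thesis using le by (simp add: Suc less_Suc_eq_le cong: conj_cong) blast
    qed simp
    moreover have "(\<exists>l<n. i \<le> l \<and> is_summand (LT n) (interval_module n (Suc i) (Suc l)) M) \<longleftrightarrow>
        (\<exists>y\<in>X. s y = i)"
    proof -
      have "is_summand (LT n) (interval_module n (Suc i) (Suc l)) M \<longleftrightarrow> (\<exists>y\<in>X. s y = i \<and> t y = l)"
        if "l < n \<and> i \<le> l" for l
        using that by (intro sm) auto
      then show ?thesis using le less by (simp cong: conj_cong) blast
    qed
    ultimately show ?thesis unfolding cohook_summand_iff by blast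
  qed
  \<comment> \<open>After the shift by one, the extreme cases \<open>i = 0\<close> and
    \<open>i = n\<close> are met by the full bar, which leaves the conditions between neighbouring
    vertices.\<close>
  have fb2: "(\<forall>i\<in>{1..n + 1}. \<exists>N\<in>cohook n i (i - 1). is_summand (LT n) N M) \<longleftrightarrow>
      (\<forall>i. Suc i < n \<longrightarrow> (\<exists>y\<in>X. s y = Suc i \<or> t y = i))" (is "?l \<longleftrightarrow> ?r")
    if z: "\<exists>z\<in>X. s z = 0 \<and> t z = n - 1"
  proof -
    have "?l \<longleftrightarrow> (\<forall>i\<le>n. \<exists>N\<in>cohook n (Suc i) i. is_summand (LT n) N M)"
    proof (intro iffI allI impI ballI)
      fix i assume l: "?l" and i: "i \<le> n"
      from bspec[OF l, of "Suc i"] i show "\<exists>N\<in>cohook n (Suc i) i. is_summand (LT n) N M" by simp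
    next
      fix i assume "\<forall>i\<le>n. \<exists>N\<in>cohook n (Suc i) i. is_summand (LT n) N M" "i \<in> {1..n + 1}"
      then show "\<exists>N\<in>cohook n i (i - 1). is_summand (LT n) N M" by (cases i) auto
    qed
    also have "\<dots> \<longleftrightarrow> (\<forall>i\<le>n. \<exists>y\<in>X. Suc (t y) = i \<or> s y = i)" using vco by auto
    also have "\<dots> \<longleftrightarrow> ?r"
    proof
      assume l: "\<forall>i\<le>n. \<exists>y\<in>X. Suc (t y) = i \<or> s y = i"
      show ?r
      proof (intro allI impI)
        fix i assume "Suc i < n"
        then show "\<exists>y\<in>X. s y = Suc i \<or> t y = i" using l[rule_format, of "Suc i"] by auto
      qed
    next
      assume r: ?r
      show "\<forall>i\<le>n. \<exists>y\<in>X. Suc (t y) = i \<or> s y = i"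
      proof (intro allI impI)
        fix i assume i: "i \<le> n"
        consider "i = 0" | "i = n" | j where "i = Suc j" "Suc j < n"
          using i by (cases i) (auto simp: le_less)
        then show "\<exists>y\<in>X. Suc (t y) = i \<or> s y = i"
        proof cases
          case 2
          obtain z where "z \<in> X" "t z = n - 1" using z by blast
          then have "Suc (t z) = i" using n 2 by simp
          then show ?thesis using \<open>z \<in> X\<close> by blast
        qed (use z r in auto)
      qed
    qed
    finally show ?thesis .
  qed
  \<comment> \<open>\<open>fb2\<close> is available only in the presence of the full bar, which both
    sides of the equivalence contain as a conjunct.\<close>
  show ?thesis
    unfolding fb full fb1 faithfully_balanced_F_iff[OF n F] using fb2 by blast
qed

theorem theorem1p1:
  fixes n :: nat and M :: "('a :: field mat, 'b) module"
  defines "\<Lambda> \<equiv> lower_triangular_ring TYPE('a) n"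
  assumes "n \<ge> 1"
    and "left_module \<Lambda> M"
    and "finitely_generated \<Lambda> M"
  shows "faithfully_balanced \<Lambda> M \<longleftrightarrow>
      is_summand \<Lambda> (interval_module n 1 n) M \<and>
      (\<forall>i j. 1 \<le> i \<and> i \<le> j \<and> j \<le> n \<and> (i, j) \<noteq> (1, n) \<and>
          is_summand \<Lambda> (interval_module n i j) M \<longrightarrow>
          (\<exists>N \<in> cohook n i j. is_summand \<Lambda> N M)) \<and>
      (\<forall>i \<in> {1..n + 1}. \<exists>N \<in> cohook n i (i - 1). is_summand \<Lambda> N M)"
proof -
  have M: "left_module (LT n) M" and fg: "finitely_generated (LT n) M"
    using assms by (simp_all add: \<Lambda>_def)
  obtain X :: "('b \<times> nat) set" and s t
    where bar: "barcode n X s t" and iso: "lmod_iso (LT n) (barcode_module n X s t) M"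
    using lower_triangular_module.barcode_decomposition[OF lower_triangular_module.intro[OF M] fg]
    by blast
  from barcode.faithfully_balanced_iff_summands[OF bar \<open>n \<ge> 1\<close> M iso] show ?thesis
    unfolding \<Lambda>_def .
qed

end
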